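(* Suppose the change-point and response models depend on an unknown random parameter $\eta$ with prior distribution $\tilde\mu$ on a Polish space $\mathcal H$. Let $\mathcal X$ be an assignment rule and $S$ a finite $\{\mathcal F_t\}$-stopping time. For each $t\ge0$, the posterior odds $\Gamma_t=\mathsf P(L_t=1\mid\mathcal F_t)/\mathsf P(L_t=0\mid\mathcal F_t)$ that $L_t=1$ given $\mathcal F_t$ is given by $$\Gamma_t=\Big(\int_{\mathcal H}\Gamma_{t,\eta}D_{t,\eta}\,\tilde\mu(d\eta)\Big)\Big/\Big(\int_{\mathcal H}D_{t,\eta}\,\tilde\mu(d\eta)\Big).$$ Further, if $\mathsf P(\Gamma_S\ge b)=1$ for some $b>0$, then $\mathsf P(S<\Theta_{\mathcal X})\le1/(1+b)$.
   Context: Setup. Fix $2\le K<\infty$, $[K]=\{1,\dots,K\}$, $\mathbb N=\{1,2,\dots\}$. There is a latent process $L_t\in\{0,1\}$, $t\ge0$, with $L_t=0$ for $t<\Theta$ and $L_t=1$ for $t\ge\Theta$; $\Theta$ is the change-point, written $\Theta_{\mathcal X}$ to stress its dependence on the assignment rule $\mathcal X$. At each $t\in\mathbb N$ a treatment $X_t\in[K]$ is selected and a response $Y_t$ in a Polish space $\mathbb Y$ is observed; $\mathcal F_t=\sigma(X_s,Y_s:1\le s\le t)$, and $\mathcal F_0$ is trivial. An assignment rule is a sequence $\mathcal X=\{X_t,t\in\mathbb N\}$ with $X_1$ deterministic and $X_t$ a deterministic (measurable) function of $X_1,\dots,X_{t-1},Y_1,\dots,Y_{t-1}$ for $t\ge2$.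 Parametric models: $\eta$ is random with law $\tilde\mu$ on the Polish space $\mathcal H$. For each $\eta\in\mathcal H$ there are $\pi_{0,\eta}\in[0,1)$, functions $\pi_{t,\eta}:[K]^t\to[0,1)$, $t\in\mathbb N$, and densities $f_{x,\eta},g_{x,\eta}$, $x\in[K]$, with respect to a $\sigma$-finite measure $\mu$ on the Borel $\sigma$-algebra of $\mathbb Y$. Conditionally on $\eta$: $\mathsf P(L_0=1)=\pi_{0,\eta}$; given $L_{t-1}=0$, $\mathcal F_{t-1}$ and $X_t$, $L_t=1$ with probability $\Pi_{t,\eta}=\pi_{t,\eta}(X_1,\dots,X_t)$; given $X_t=x$, $L_t=i$, $\mathcal F_{t-1}$ and $L_0,\dots,L_{t-1}$, the response $Y_t$ has density $f_{x,\eta}$ if $i=0$ and $g_{x,\eta}$ if $i=1$. Definitions: $\Gamma_{0,\eta}=\pi_{0,\eta}/(1-\pi_{0,\eta})$ and, for $t\in\mathbb N$, $\Gamma_{t,\eta}=(\Gamma_{t-1,\eta}+\Pi_{t,\eta})\dfrac{\Lambda_{t,\eta}}{1-\Pi_{t,\eta}}$ with $\Lambda_{t,\eta}=\dfrac{g_{X_t,\eta}(Y_t)}{f_{X_t,\eta}(Y_t)}$; $D_{0,\eta}=1-\pi_{0,\eta}$ and $D_{t,\eta}=D_{0,\eta}\prod_{s=1}^t(1-\Pi_{s,\eta})f_{X_s,\eta}(Y_s)$ for $t\ge1$.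
   Formalization: The formula for Γ_t is stated (almost surely) under the added condition that, for each x and prior-almost every η, g_{x,η}dμ is absolutely continuous w.r.t. f_{x,η}dμ; otherwise Γ_{t,η}D_{t,η} can be the undefined ∞·0. The error bound is stated without this condition. *)

theory Defs
  imports "HOL-Probability.Probability" "HOL-Library.Extended_Nat"
begin

definition events_of :: "'a measure \<Rightarrow> 'b measure \<Rightarrow> ('a \<Rightarrow> 'b) \<Rightarrow> 'a set set" where
  "events_of M N Z = {Z -` B \<inter> space M | B. B \<in> sets N}"

text \<open>
  The observation filtration is indexed by \<^typ>\<open>enat\<close>, so that stopping times may take the value
  \<open>\<infinity>\<close>; at \<open>\<infinity>\<close> it is the \<open>\<sigma>\<close>-algebra generated by all observations, at \<open>0\<close> it is trivial.
\<close>
definition obs_filtration ::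
    "'a measure \<Rightarrow> (nat \<Rightarrow> 'a \<Rightarrow> nat) \<Rightarrow> (nat \<Rightarrow> 'a \<Rightarrow> 'y::topological_space) \<Rightarrow> enat \<Rightarrow> 'a measure" where
  "obs_filtration M X Y t =
     sigma (space M) (\<Union>s\<in>{s. 1 \<le> s \<and> enat s \<le> t}.
       events_of M (count_space UNIV) (X s) \<union> events_of M borel (Y s))"

definition latent :: "('a \<Rightarrow> enat) \<Rightarrow> nat \<Rightarrow> 'a \<Rightarrow> nat" where
  "latent \<Theta> t \<omega> = (if enat t < \<Theta> \<omega> then 0 else 1)"

definition cond_prob_given :: "'a measure \<Rightarrow> 'a measure \<Rightarrow> ('a \<Rightarrow> bool) \<Rightarrow> 'a \<Rightarrow> real" where
  "cond_prob_given M G P = real_cond_exp M G (indicat_real {\<omega> \<in> space M. P \<omega>})"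

definition assignment_rule ::
    "nat \<Rightarrow> 'a measure \<Rightarrow> (nat \<Rightarrow> 'a \<Rightarrow> nat) \<Rightarrow> (nat \<Rightarrow> 'a \<Rightarrow> 'y::topological_space) \<Rightarrow> bool" where
  "assignment_rule K M X Y \<longleftrightarrow>
     (\<exists>x\<in>{1..K}. \<forall>\<omega>\<in>space M. X 1 \<omega> = x) \<and>
     (\<forall>t\<ge>2. \<exists>\<phi> \<in> (\<Pi>\<^sub>M s\<in>{1..<t}. count_space {1..K}) \<Otimes>\<^sub>M (\<Pi>\<^sub>M s\<in>{1..<t}. borel)
                  \<rightarrow>\<^sub>M count_space {1..K}.
        \<forall>\<omega>\<in>space M. X t \<omega> = \<phi> (\<lambda>s\<in>{1..<t}. X s \<omega>, \<lambda>s\<in>{1..<t}. Y s \<omega>))"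

definition trans_prob ::
    "(nat \<Rightarrow> 'h \<Rightarrow> (nat \<Rightarrow> nat) \<Rightarrow> real) \<Rightarrow> (nat \<Rightarrow> 'a \<Rightarrow> nat) \<Rightarrow> nat \<Rightarrow> 'h \<Rightarrow> 'a \<Rightarrow> real" where
  "trans_prob p X t h \<omega> = p t h (\<lambda>s\<in>{1..t}. X s \<omega>)"

text \<open>
  \<open>\<eta>\<close> is the random parameter with law \<open>prior\<close>; \<open>h\<close> ranges over its values. The set
  \<open>[K]\<^sup>t\<close> is represented by the extensional functions from \<open>{1..t}\<close> to \<open>{1..K}\<close>.
\<close>
locale changepoint_model =
  prob_space M + prior: prob_space prior + mu: sigma_finite_measure \<mu>
  for M :: "'a measure"
    and prior :: "'h::polish_space measure"
    and \<mu> :: "'y::polish_space measure" +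
  fixes K :: nat
    and p0 :: "'h \<Rightarrow> real"
    and p :: "nat \<Rightarrow> 'h \<Rightarrow> (nat \<Rightarrow> nat) \<Rightarrow> real"
    and f g :: "nat \<Rightarrow> 'h \<Rightarrow> 'y \<Rightarrow> real"
    and \<eta> :: "'a \<Rightarrow> 'h"
    and \<Theta> :: "'a \<Rightarrow> enat"
    and X :: "nat \<Rightarrow> 'a \<Rightarrow> nat"
    and Y :: "nat \<Rightarrow> 'a \<Rightarrow> 'y"
  assumes K_ge_2: "2 \<le> K"
    and sets_prior: "sets prior = sets borel"
    and sets_mu: "sets \<mu> = sets borel"
    and p0_measurable: "p0 \<in> borel_measurable borel"
    and p0_range: "\<And>h. p0 h \<in> {0..<1}"
    and p_measurable: "\<And>t x. 1 \<le> t \<Longrightarrow> x \<in> {1..t} \<rightarrow>\<^sub>E {1..K} \<Longrightarrow> (\<lambda>h. p t h x) \<in> borel_measurable borel"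
    and p_range: "\<And>t h x. 1 \<le> t \<Longrightarrow> x \<in> {1..t} \<rightarrow>\<^sub>E {1..K} \<Longrightarrow> p t h x \<in> {0..<1}"
    and f_measurable: "\<And>x. x \<in> {1..K} \<Longrightarrow> (\<lambda>(h, y). f x h y) \<in> borel_measurable (borel \<Otimes>\<^sub>M borel)"
    and g_measurable: "\<And>x. x \<in> {1..K} \<Longrightarrow> (\<lambda>(h, y). g x h y) \<in> borel_measurable (borel \<Otimes>\<^sub>M borel)"
    and f_nonneg: "\<And>x h y. x \<in> {1..K} \<Longrightarrow> 0 \<le> f x h y"
    and g_nonneg: "\<And>x h y. x \<in> {1..K} \<Longrightarrow> 0 \<le> g x h y"
    and f_density: "\<And>x h. x \<in> {1..K} \<Longrightarrow> (\<integral>\<^sup>+y. ennreal (f x h y) \<partial>\<mu>) = 1"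
    and g_density: "\<And>x h. x \<in> {1..K} \<Longrightarrow> (\<integral>\<^sup>+y. ennreal (g x h y) \<partial>\<mu>) = 1"
    and eta_measurable: "\<eta> \<in> M \<rightarrow>\<^sub>M borel"
    and Theta_measurable: "\<Theta> \<in> M \<rightarrow>\<^sub>M count_space UNIV"
    and Y_measurable: "\<And>t. 1 \<le> t \<Longrightarrow> Y t \<in> M \<rightarrow>\<^sub>M borel"
    and eta_law: "distr M borel \<eta> = prior"
    and initial_law:
      "AE \<omega> in M. cond_prob_given M (sigma (space M) (events_of M borel \<eta>))
         (\<lambda>\<omega>. latent \<Theta> 0 \<omega> = 1) \<omega> = p0 (\<eta> \<omega>)"
    and transition_law:
      "\<And>t. 1 \<le> t \<Longrightarrow> AE \<omega> in M. latent \<Theta> (t - 1) \<omega> = 0 \<longrightarrow>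
         cond_prob_given M
           (sigma (space M) (events_of M borel \<eta>
              \<union> events_of M (count_space UNIV) (latent \<Theta> (t - 1))
              \<union> sets (obs_filtration M X Y (enat (t - 1)))
              \<union> events_of M (count_space UNIV) (X t)))
           (\<lambda>\<omega>. latent \<Theta> t \<omega> = 1) \<omega> = trans_prob p X t (\<eta> \<omega>) \<omega>"
    and response_law:
      "\<And>t B. 1 \<le> t \<Longrightarrow> B \<in> sets borel \<Longrightarrow> AE \<omega> in M.
         cond_prob_given M
           (sigma (space M) (events_of M borel \<eta>
              \<union> (\<Union>s\<in>{0..t}. events_of M (count_space UNIV) (latent \<Theta> s))
              \<union> sets (obs_filtration M X Y (enat (t - 1)))
              \<union> events_of M (count_space UNIV) (X t)))
           (\<lambda>\<omega>. Y t \<omega> \<in> B) \<omega> =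
         measure (density \<mu> (\<lambda>y. ennreal
           (if latent \<Theta> t \<omega> = 0 then f (X t \<omega>) (\<eta> \<omega>) y else g (X t \<omega>) (\<eta> \<omega>) y))) B"

definition lik_ratio ::
    "(nat \<Rightarrow> 'h \<Rightarrow> 'y \<Rightarrow> real) \<Rightarrow> (nat \<Rightarrow> 'h \<Rightarrow> 'y \<Rightarrow> real) \<Rightarrow> (nat \<Rightarrow> 'a \<Rightarrow> nat) \<Rightarrow> (nat \<Rightarrow> 'a \<Rightarrow> 'y) \<Rightarrow>
     nat \<Rightarrow> 'h \<Rightarrow> 'a \<Rightarrow> real" where
  "lik_ratio f g X Y t h \<omega> = g (X t \<omega>) h (Y t \<omega>) / f (X t \<omega>) h (Y t \<omega>)"

primrec Gamma_par ::
    "('h \<Rightarrow> real) \<Rightarrow> (nat \<Rightarrow> 'h \<Rightarrow> (nat \<Rightarrow> nat) \<Rightarrow> real) \<Rightarrow>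
     (nat \<Rightarrow> 'h \<Rightarrow> 'y \<Rightarrow> real) \<Rightarrow> (nat \<Rightarrow> 'h \<Rightarrow> 'y \<Rightarrow> real) \<Rightarrow>
     (nat \<Rightarrow> 'a \<Rightarrow> nat) \<Rightarrow> (nat \<Rightarrow> 'a \<Rightarrow> 'y) \<Rightarrow> nat \<Rightarrow> 'h \<Rightarrow> 'a \<Rightarrow> real" where
  "Gamma_par p0 p f g X Y 0 h \<omega> = p0 h / (1 - p0 h)"
| "Gamma_par p0 p f g X Y (Suc t) h \<omega> =
     (Gamma_par p0 p f g X Y t h \<omega> + trans_prob p X (Suc t) h \<omega>) *
     (lik_ratio f g X Y (Suc t) h \<omega> / (1 - trans_prob p X (Suc t) h \<omega>))"

definition D_par ::
    "('h \<Rightarrow> real) \<Rightarrow> (nat \<Rightarrow> 'h \<Rightarrow> (nat \<Rightarrow> nat) \<Rightarrow> real) \<Rightarrow> (nat \<Rightarrow> 'h \<Rightarrow> 'y \<Rightarrow> real) \<Rightarrow>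
     (nat \<Rightarrow> 'a \<Rightarrow> nat) \<Rightarrow> (nat \<Rightarrow> 'a \<Rightarrow> 'y) \<Rightarrow> nat \<Rightarrow> 'h \<Rightarrow> 'a \<Rightarrow> real" where
  "D_par p0 p f X Y t h \<omega> =
     (1 - p0 h) * (\<Prod>s=1..t. (1 - trans_prob p X s h \<omega>) * f (X s \<omega>) h (Y s \<omega>))"

text \<open>
  Odds are taken in \<^typ>\<open>ennreal\<close>: they are \<open>\<infinity>\<close> where \<open>L\<^sub>t = 0\<close> has posterior probability zero.
\<close>
definition posterior_odds ::
    "'a measure \<Rightarrow> (nat \<Rightarrow> 'a \<Rightarrow> nat) \<Rightarrow> (nat \<Rightarrow> 'a \<Rightarrow> 'y::topological_space) \<Rightarrow> ('a \<Rightarrow> enat) \<Rightarrow>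
     nat \<Rightarrow> 'a \<Rightarrow> ennreal" where
  "posterior_odds M X Y \<Theta> t \<omega> =
     ennreal (cond_prob_given M (obs_filtration M X Y (enat t)) (\<lambda>\<omega>. latent \<Theta> t \<omega> = 1) \<omega>) /
     ennreal (cond_prob_given M (obs_filtration M X Y (enat t)) (\<lambda>\<omega>. latent \<Theta> t \<omega> = 0) \<omega>)"

text \<open>
  The condition under which every likelihood ratio \<open>g / f\<close> is finite almost surely. If it
  fails, \<open>\<Gamma>\<^bsub>t,h\<^esub> D\<^bsub>t,h\<^esub>\<close> can be of the undefined form \<open>\<infinity> \<cdot> 0\<close>.
\<close>
definition lik_ratio_well_defined ::
    "nat \<Rightarrow> 'h measure \<Rightarrow> 'y measure \<Rightarrow> (nat \<Rightarrow> 'h \<Rightarrow> 'y \<Rightarrow> real) \<Rightarrow> (nat \<Rightarrow> 'h \<Rightarrow> 'y \<Rightarrow> real) \<Rightarrow> bool" where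
  "lik_ratio_well_defined K prior \<mu> f g \<longleftrightarrow>
     (\<forall>x\<in>{1..K}. AE h in prior.
        absolutely_continuous (density \<mu> (\<lambda>y. ennreal (f x h y))) (density \<mu> (\<lambda>y. ennreal (g x h y))))"

end

theory Submission
  imports Defs
begin

text \<open>
  Under an assignment rule every treatment is a function \<open>\<xi>\<^sub>s\<close> of the earlier responses, so the joint
  law of \<open>(\<eta>, Y\<^sub>1, \<dots>, Y\<^sub>t)\<close> on each of the events \<open>L\<^sub>t = 0\<close> and \<open>L\<^sub>t = 1\<close> has a density with respect
  to \<open>prior \<Otimes> \<mu>\<^sup>t\<close>. By induction on \<open>t\<close> these densities are \<open>D\<^sub>t\<close> and a function \<open>N\<^sub>t\<close> given by
  \<open>N\<^sub>t\<^sub>+\<^sub>1 = (N\<^sub>t + \<Pi>\<^sub>t\<^sub>+\<^sub>1 D\<^sub>t) g\<close>, which involves no division; integrating \<open>\<eta>\<close> out, Bayes' formula gives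
  the odds as \<open>\<integral>N\<^sub>t / \<integral>D\<^sub>t\<close>. The law of every \<open>Y\<^sub>s\<close> is absolutely continuous with respect to \<open>\<mu>\<close>, hence
  almost surely \<open>g\<close> vanishes wherever \<open>f\<close> does, and there \<open>N\<^sub>t = \<Gamma>\<^sub>t D\<^sub>t\<close>.

  For the error bound, \<open>S = t\<close> is decided by the first \<open>t\<close> observations, so the probability of
  \<open>S < \<Theta>\<close> is the sum over \<open>t\<close> of the integrals of the posterior probability of \<open>L\<^sub>t = 0\<close> over \<open>S = t\<close>,
  and that probability is at most \<open>1 / (1 + b)\<close> when the odds are at least \<open>b\<close>.
\<close>

section \<open>Conditional probabilities\<close>

lemma events_of_subset_sets: "Z \<in> G \<rightarrow>\<^sub>M N \<Longrightarrow> space G = space M \<Longrightarrow> events_of M N Z \<subseteq> sets G"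
  using measurable_sets[of Z G N] by (auto simp: events_of_def)

lemma subalgebra_sigma: "G \<subseteq> sets M \<Longrightarrow> subalgebra M (sigma (space M) G)"
  using sets.sigma_sets_subset[of G M] sets.space_closed[of M]
  by (auto simp: subalgebra_def sets_measure_of_conv space_measure_of_conv split: if_splits)

lemma measurable_sigma_events_of:
  assumes "G \<subseteq> Pow (space M)" "events_of M N Z \<subseteq> G" "Z \<in> space M \<rightarrow> space N"
  shows "Z \<in> sigma (space M) G \<rightarrow>\<^sub>M N"
proof (rule measurableI)
  fix B assume "B \<in> sets N"
  then have "Z -` B \<inter> space M \<in> G" using assms(2) by (auto simp: events_of_def)
  then show "Z -` B \<inter> space (sigma (space M) G) \<in> sets (sigma (space M) G)"
    using assms(1) by (auto simp: space_measure_of_conv)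
qed (use assms in \<open>auto simp: space_measure_of_conv\<close>)

context prob_space
begin

lemma finite_measure_subalgebra: "subalgebra M G \<Longrightarrow> finite_measure_subalgebra M G"
  by unfold_locales

lemma cond_prob_given_nonneg:
  assumes G: "subalgebra M G" and [measurable]: "Measurable.pred M P"
  shows "AE \<omega> in M. 0 \<le> cond_prob_given M G P \<omega>"
proof -
  interpret finite_measure_subalgebra M G by (rule finite_measure_subalgebra[OF G])
  show ?thesis unfolding cond_prob_given_def by (rule real_cond_exp_pos) auto
qed

text \<open>The initial and transition laws prescribe the probability of state 1 only; state 0
  enters the recursion through this complement rule, which is linearity of conditional
  expectation.\<close>

lemma cond_prob_given_not:
  assumes G: "subalgebra M G" and [measurable]: "Measurable.pred M P"
  shows "AE \<omega> in M. cond_prob_given M G (\<lambda>\<omega>. \<not> P \<omega>) \<omega> = 1 - cond_prob_given M G P \<omega>"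
proof -
  interpret finite_measure_subalgebra M G by (rule finite_measure_subalgebra[OF G])
  let ?P = "indicat_real {\<omega> \<in> space M. P \<omega>}" and ?N = "indicat_real {\<omega> \<in> space M. \<not> P \<omega>}"
  have "AE \<omega> in M. real_cond_exp M G (\<lambda>\<omega>. 1 - ?P \<omega>) \<omega>
      = real_cond_exp M G (\<lambda>_. 1) \<omega> - real_cond_exp M G ?P \<omega>"
    by (rule real_cond_exp_diff) (auto simp: emeasure_eq_measure)
  moreover have "AE \<omega> in M. real_cond_exp M G (\<lambda>_. 1) \<omega> = 1"
    by (rule real_cond_exp_F_meas) auto
  moreover have "AE \<omega> in M. real_cond_exp M G (\<lambda>\<omega>. 1 - ?P \<omega>) \<omega> = real_cond_exp M G ?N \<omega>"
    by (rule real_cond_exp_cong) (auto split: split_indicator)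
  ultimately show ?thesis unfolding cond_prob_given_def by eventually_elim simp
qed

text \<open>\<open>real_cond_exp\<close> is the difference of the \<open>enn2real\<close> values of
  \<open>nn_cond_exp\<close> for the positive and the negative part. For an indicator the negative
  part contributes 0, and the bound by 1 ensures that \<open>enn2real\<close> discards no infinite
  value.\<close>

lemma ennreal_cond_prob_given:
  assumes G: "subalgebra M G" and P[measurable]: "Measurable.pred M P"
  shows "AE \<omega> in M. ennreal (cond_prob_given M G P \<omega>) =
    nn_cond_exp M G (indicator {\<omega> \<in> space M. P \<omega>}) \<omega>"
proof -
  interpret finite_measure_subalgebra M G by (rule finite_measure_subalgebra[OF G])
  let ?P = "indicat_real {\<omega> \<in> space M. P \<omega>}"
  let ?n = "nn_cond_exp M G (indicator {\<omega> \<in> space M. P \<omega>})"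
  have P_eq: "(\<lambda>\<omega>. ennreal (?P \<omega>)) = indicator {\<omega> \<in> space M. P \<omega>}"
    by (simp add: fun_eq_iff ennreal_indicator)
  have "AE \<omega> in M. nn_cond_exp M G (\<lambda>\<omega>. ennreal (- ?P \<omega>)) \<omega> = nn_cond_exp M G (\<lambda>\<omega>. 0) \<omega>"
    by (rule nn_cond_exp_cong) (auto simp: ennreal_neg)
  moreover have "AE \<omega> in M. 0 = nn_cond_exp M G (\<lambda>\<omega>. 0) \<omega>"
    by (rule nn_cond_exp_F_meas) auto
  moreover have "AE \<omega> in M. ?n \<omega> \<le> nn_cond_exp M G (\<lambda>\<omega>. 1) \<omega>"
    by (rule nn_cond_exp_mono) (auto split: split_indicator)
  moreover have "AE \<omega> in M. 1 = nn_cond_exp M G (\<lambda>\<omega>. 1) \<omega>"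
    by (rule nn_cond_exp_F_meas) auto
  ultimately show ?thesis
  proof eventually_elim
    case (elim \<omega>)
    then have "?n \<omega> \<le> 1" by simp
    then have "?n \<omega> < top" by (simp add: order_le_less_trans)
    then show ?case using elim by (simp add: cond_prob_given_def real_cond_exp_def P_eq)
  qed
qed

text \<open>The averaged form in which all conditional laws are used. \<open>R\<close> marks where
  the law is known, since the transition law speaks only about the event that the previous state is
  0; the test function has to vanish elsewhere.\<close>

lemma nn_integral_cond_prob_given:
  assumes G: "subalgebra M G" and P[measurable]: "Measurable.pred M P"
    and \<phi>[measurable]: "\<phi> \<in> borel_measurable G"
    and q: "AE \<omega> in M. R \<omega> \<longrightarrow> cond_prob_given M G P \<omega> = q \<omega>"
    and R: "\<And>\<omega>. \<omega> \<in> space M \<Longrightarrow> \<not> R \<omega> \<Longrightarrow> \<phi> \<omega> = 0"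
  shows "(\<integral>\<^sup>+\<omega>. \<phi> \<omega> * indicator {\<omega>. P \<omega>} \<omega> \<partial>M) = (\<integral>\<^sup>+\<omega>. \<phi> \<omega> * ennreal (q \<omega>) \<partial>M)"
proof -
  interpret finite_measure_subalgebra M G by (rule finite_measure_subalgebra[OF G])
  let ?P = "indicator {\<omega> \<in> space M. P \<omega>}"
  have "(\<integral>\<^sup>+\<omega>. \<phi> \<omega> * indicator {\<omega>. P \<omega>} \<omega> \<partial>M) = (\<integral>\<^sup>+\<omega>. \<phi> \<omega> * ?P \<omega> \<partial>M)"
    by (rule nn_integral_cong) (auto split: split_indicator)
  also have "\<dots> = (\<integral>\<^sup>+\<omega>. \<phi> \<omega> * nn_cond_exp M G ?P \<omega> \<partial>M)"
    by (rule nn_cond_exp_intg[symmetric]) auto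
  also have "\<dots> = (\<integral>\<^sup>+\<omega>. \<phi> \<omega> * ennreal (q \<omega>) \<partial>M)"
  proof (rule nn_integral_cong_AE)
    show "AE \<omega> in M. \<phi> \<omega> * nn_cond_exp M G ?P \<omega> = \<phi> \<omega> * ennreal (q \<omega>)"
      using ennreal_cond_prob_given[OF G P] q AE_space by eventually_elim (metis R mult_zero_left)
  qed
  finally show ?thesis .
qed

end

section \<open>The error bound at a stopping time\<close>

lemma sets_sigma_mono: "A \<subseteq> B \<Longrightarrow> B \<subseteq> Pow S \<Longrightarrow> sets (sigma S A) \<subseteq> sets (sigma S B)"
  by (simp add: sigma_sets_mono')

lemma events_of_subset_Pow: "events_of M N Z \<subseteq> Pow (space M)"
  by (auto simp: events_of_def)

lemma sets_obs_filtration_mono: "s \<le> t \<Longrightarrow> sets (obs_filtration M X Y s) \<subseteq> sets (obs_filtration M X Y t)"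
  unfolding obs_filtration_def
  by (intro sets_sigma_mono UN_mono UN_least Un_least events_of_subset_Pow) auto

lemma subalgebra_obs_filtration:
  assumes "\<And>s. 1 \<le> s \<Longrightarrow> X s \<in> M \<rightarrow>\<^sub>M count_space UNIV"
    and "\<And>s. 1 \<le> s \<Longrightarrow> Y s \<in> M \<rightarrow>\<^sub>M borel"
  shows "subalgebra M (obs_filtration M X Y t)"
  unfolding obs_filtration_def
  by (intro subalgebra_sigma UN_least Un_least events_of_subset_sets assms) auto

lemma measurable_latent:
  assumes [measurable]: "\<Theta> \<in> M \<rightarrow>\<^sub>M count_space UNIV"
  shows "latent \<Theta> t \<in> M \<rightarrow>\<^sub>M count_space UNIV"
  unfolding latent_def by measurable

lemma pred_latent_eq:
  assumes [measurable]: "\<Theta> \<in> M \<rightarrow>\<^sub>M count_space UNIV"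
  shows "Measurable.pred M (\<lambda>\<omega>. latent \<Theta> t \<omega> = i)"
  using measurable_latent[OF assms] by (rule pred_eq_const1) simp

lemma latent_eq_1_iff: "latent \<Theta> t \<omega> = 1 \<longleftrightarrow> latent \<Theta> t \<omega> \<noteq> 0"
  by (simp add: latent_def)

text \<open>An average of posterior probabilities at the random time \<open>S\<close> inherits their
  common bound. The argument starts from the definition of \<open>posterior_odds\<close> and does
  not pass through the integral formula.\<close>

lemma (in prob_space) stopped_posterior_odds_bound:
  fixes X :: "nat \<Rightarrow> 'a \<Rightarrow> nat" and Y :: "nat \<Rightarrow> 'a \<Rightarrow> 'y::topological_space"
  assumes X: "\<And>s. 1 \<le> s \<Longrightarrow> X s \<in> M \<rightarrow>\<^sub>M count_space UNIV"
    and Y: "\<And>s. 1 \<le> s \<Longrightarrow> Y s \<in> M \<rightarrow>\<^sub>M borel"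
    and \<Theta>[measurable]: "\<Theta> \<in> M \<rightarrow>\<^sub>M count_space UNIV"
    and S: "stopping_time (obs_filtration M X Y) S"
    and fin: "AE \<omega> in M. S \<omega> < \<infinity>"
    and b: "0 < b"
    and odds: "\<P>(\<omega> in M. ennreal b \<le> posterior_odds M X Y \<Theta> (the_enat (S \<omega>)) \<omega>) = 1"
  shows "\<P>(\<omega> in M. S \<omega> < \<Theta> \<omega>) \<le> 1 / (1 + b)"
proof -
  let ?F = "\<lambda>t. obs_filtration M X Y (enat t)"
  let ?P0 = "\<lambda>t. cond_prob_given M (?F t) (\<lambda>\<omega>. latent \<Theta> t \<omega> = 0)"
  let ?P1 = "\<lambda>t. cond_prob_given M (?F t) (\<lambda>\<omega>. latent \<Theta> t \<omega> = 1)"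
  have sub: "subalgebra M (obs_filtration M X Y t)" for t
    by (rule subalgebra_obs_filtration[OF X Y])
  note lat = pred_latent_eq[OF \<Theta>]
  have S_le: "Measurable.pred (?F t) (\<lambda>\<omega>. S \<omega> \<le> enat s)" if "s \<le> t" for s t
    by (rule measurable_from_subalg[OF _ stopping_timeD[OF S]])
      (use sub sets_obs_filtration_mono[of "enat s" "enat t"] that in \<open>simp add: subalgebra_def\<close>)
  \<comment> \<open>The event \<open>S = enat t\<close> is \<open>S \<le> enat t\<close> without
    \<open>S \<le> enat (t - 1)\<close>; time 0 has no predecessor and is treated apart.\<close>
  have S_eq: "Measurable.pred (?F t) (\<lambda>\<omega>. S \<omega> = enat t)" for t
  proof (cases t)
    case 0
    then have "(\<lambda>\<omega>. S \<omega> = enat t) = (\<lambda>\<omega>. S \<omega> \<le> enat t)" by (auto simp: fun_eq_iff zero_enat_def[symmetric])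
    then show ?thesis using S_le[of t t] by simp
  next
    case (Suc n)
    then have "(\<lambda>\<omega>. S \<omega> = enat t) = (\<lambda>\<omega>. S \<omega> \<le> enat t \<and> \<not> S \<omega> \<le> enat n)"
      by (intro ext; case_tac "S \<omega>") auto
    then show ?thesis using S_le[of t t] S_le[of n t] Suc by simp
  qed
  have ind_F: "(\<lambda>\<omega>. indicator {\<omega>. S \<omega> = enat t} \<omega> :: ennreal) \<in> borel_measurable (?F t)" for t
    using S_eq[of t] by (intro borel_measurable_indicator') (simp add: Measurable.pred_def)
  have ind_M: "(\<lambda>\<omega>. indicator {\<omega>. S \<omega> = enat t} \<omega> :: ennreal) \<in> borel_measurable M" for t
    by (rule measurable_from_subalg[OF sub ind_F])
  \<comment> \<open>A set outside \<open>events\<close> has measure 0, so probability 1 also makes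
    the event measurable.\<close>
  have ae_odds: "AE \<omega> in M. ennreal b \<le> posterior_odds M X Y \<Theta> (the_enat (S \<omega>)) \<omega>"
    using AE_prob_1[OF odds] by eventually_elim simp
  have "AE \<omega> in M. \<forall>t. ?P1 t \<omega> = 1 - ?P0 t \<omega>"
    unfolding latent_eq_1_iff AE_all_countable
    by (intro allI cond_prob_given_not sub lat)
  moreover have "AE \<omega> in M. \<forall>t. 0 \<le> ?P0 t \<omega>"
    unfolding AE_all_countable by (intro allI cond_prob_given_nonneg sub lat)
  ultimately have P0_le: "AE \<omega> in M. \<forall>t. S \<omega> = enat t \<longrightarrow> ?P0 t \<omega> \<le> 1 / (1 + b)"
    using ae_odds
  proof eventually_elim
    case (elim \<omega>)
    show ?case
    proof (intro allI impI)
      fix t assume t: "S \<omega> = enat t"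
      have le: "ennreal b \<le> ennreal (1 - ?P0 t \<omega>) / ennreal (?P0 t \<omega>)"
        using elim t by (simp add: posterior_odds_def)
      show "?P0 t \<omega> \<le> 1 / (1 + b)"
      \<comment> \<open>With a zero denominator the odds carry no real inequality, but the claim
        then only says \<open>0 \<le> 1 / (1 + b)\<close>.\<close>
      proof (cases "?P0 t \<omega> = 0")
        case False
        then have pos: "0 < ?P0 t \<omega>" using elim by (metis less_le)
        \<comment> \<open>\<open>ennreal\<close> sends negative reals to 0, so a nonpositive
          numerator would make the odds 0, which is below \<open>b\<close>. Hence the quotient is
          the real one.\<close>
        have "0 < 1 - ?P0 t \<omega>"
          using le b by (cases "0 < 1 - ?P0 t \<omega>") (auto simp: ennreal_neg not_less)
        then have "b \<le> (1 - ?P0 t \<omega>) / ?P0 t \<omega>"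
          using le pos by (simp add: divide_ennreal)
        then show ?thesis using pos b by (simp add: field_simps)
      qed (use b in simp)
    qed
  qed
  \<comment> \<open>A sum over all \<open>t\<close> stands for evaluation at the random time; its
    terms involve deterministic times only, where conditioning on \<open>?F t\<close>
    applies.\<close>
  have sum_S: "(\<Sum>t. indicator {\<omega>. S \<omega> = enat t} \<omega> * c t) = c n" if S_n: "S \<omega> = enat n"
    for \<omega> :: 'a and n :: nat and c :: "nat \<Rightarrow> ennreal"
  proof -
    have "(\<Sum>t. indicator {\<omega>. S \<omega> = enat t} \<omega> * c t) = (\<Sum>t\<in>{n}. indicator {\<omega>. S \<omega> = enat t} \<omega> * c t)"
      by (rule suminf_finite) (simp_all add: S_n)
    then show ?thesis by (simp add: S_n)
  qed
  have "emeasure M {\<omega> \<in> space M. S \<omega> < \<Theta> \<omega>} \<le> ennreal (1 / (1 + b))"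
  proof -
    have "AE \<omega> in M. indicator {\<omega> \<in> space M. S \<omega> < \<Theta> \<omega>} \<omega>
        = (\<Sum>t. indicator {\<omega>. S \<omega> = enat t} \<omega> * (indicator {\<omega>. latent \<Theta> t \<omega> = 0} \<omega> :: ennreal))"
      using fin AE_space
    proof eventually_elim
      case (elim \<omega>)
      then obtain n where "S \<omega> = enat n" by auto
      with elim show ?case
        by (subst sum_S) (auto simp: latent_def split: split_indicator)
    qed
    then have "(\<integral>\<^sup>+\<omega>. indicator {\<omega> \<in> space M. S \<omega> < \<Theta> \<omega>} \<omega> \<partial>M)
        = (\<integral>\<^sup>+\<omega>. (\<Sum>t. indicator {\<omega>. S \<omega> = enat t} \<omega> * indicator {\<omega>. latent \<Theta> t \<omega> = 0} \<omega>) \<partial>M)"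
      by (rule nn_integral_cong_AE)
    also have "\<dots> = (\<Sum>t. \<integral>\<^sup>+\<omega>. indicator {\<omega>. S \<omega> = enat t} \<omega> * indicator {\<omega>. latent \<Theta> t \<omega> = 0} \<omega> \<partial>M)"
      
      by (intro nn_integral_suminf borel_measurable_times_ennreal borel_measurable_indicator' ind_M)
        (use lat in \<open>simp add: Measurable.pred_def\<close>)
    also have "\<dots> = (\<Sum>t. \<integral>\<^sup>+\<omega>. indicator {\<omega>. S \<omega> = enat t} \<omega> * ennreal (?P0 t \<omega>) \<partial>M)"
      by (intro suminf_cong nn_integral_cond_prob_given[OF sub lat ind_F, where R="\<lambda>_. True"]) auto
    also have "\<dots> = (\<integral>\<^sup>+\<omega>. (\<Sum>t. indicator {\<omega>. S \<omega> = enat t} \<omega> * ennreal (?P0 t \<omega>)) \<partial>M)"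
      unfolding cond_prob_given_def 
      by (intro nn_integral_suminf[symmetric] borel_measurable_times_ennreal ind_M) measurable
    also have "\<dots> \<le> (\<integral>\<^sup>+\<omega>. ennreal (1 / (1 + b)) \<partial>M)"
    proof (rule nn_integral_mono_AE)
      show "AE \<omega> in M. (\<Sum>t. indicator {\<omega>. S \<omega> = enat t} \<omega> * ennreal (?P0 t \<omega>)) \<le> ennreal (1 / (1 + b))"
        using fin P0_le
      proof eventually_elim
        case (elim \<omega>)
        then obtain n where "S \<omega> = enat n" by auto
        with elim show ?case
          by (subst sum_S) (auto intro!: ennreal_leI)
      qed
    qed
    also have "\<dots> = ennreal (1 / (1 + b))" by (simp add: emeasure_space_1)
    finally have "(\<integral>\<^sup>+\<omega>. indicator {\<omega> \<in> space M. S \<omega> < \<Theta> \<omega>} \<omega> \<partial>M) \<le> ennreal (1 / (1 + b))" .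
    \<comment> \<open>If the event were not measurable, its \<open>emeasure\<close> would be 0 and
      the bound would still hold.\<close>
    then show ?thesis
      by (cases "{\<omega> \<in> space M. S \<omega> < \<Theta> \<omega>} \<in> events") (auto simp: emeasure_notin_sets)
  qed
  then show ?thesis using b by (simp add: emeasure_eq_measure)
qed

section \<open>Assignment rules as policies\<close>

text \<open>Strong induction on \<open>s\<close>: the treatments that the rule reads are replaced by
  the functions of responses already found for them. The congruence clause controls \<xi> on
  arbitrary functions, whereas measurability concerns only the extensional ones that form the
  product space.\<close>

lemma assignment_rule_policy:
  assumes rule: "assignment_rule K M X (Y :: nat \<Rightarrow> 'a \<Rightarrow> 'y::topological_space)"
  shows "\<exists>\<xi>. (\<forall>s\<ge>1. \<xi> s \<in> (\<Pi>\<^sub>M r\<in>{1..<s}. borel) \<rightarrow>\<^sub>M count_space {1..K}) \<and>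
    (\<forall>s\<ge>1. \<forall>y y'. (\<forall>r\<in>{1..<s}. y r = y' r) \<longrightarrow> \<xi> s y = \<xi> s y') \<and>
    (\<forall>s\<ge>1. \<forall>\<omega>\<in>space M. X s \<omega> = \<xi> s (\<lambda>r. Y r \<omega>))"
proof -
  let ?Q = "\<lambda>s \<zeta>. \<zeta> \<in> (\<Pi>\<^sub>M r\<in>{1..<s}. borel) \<rightarrow>\<^sub>M count_space {1..K} \<and>
    (\<forall>y y'. (\<forall>r\<in>{1..<s}. y r = y' r) \<longrightarrow> \<zeta> y = \<zeta> y') \<and>
    (\<forall>\<omega>\<in>space M. X s \<omega> = \<zeta> (\<lambda>r. Y r \<omega>))"
  have "\<exists>\<zeta>. ?Q s \<zeta>" if "1 \<le> s" for s
    using that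
  proof (induction s rule: less_induct)
    case (less s)
    show ?case
    proof (cases "s = 1")
      case True
      then obtain x where "x \<in> {1..K}" "\<forall>\<omega>\<in>space M. X 1 \<omega> = x"
        using rule by (auto simp: assignment_rule_def)
      then show ?thesis using True by (intro exI[of _ "\<lambda>_. x"]) auto
    next
      case False
      then have "2 \<le> s" using less.prems by simp
      then obtain \<phi> where \<phi>: "\<phi> \<in> (\<Pi>\<^sub>M r\<in>{1..<s}. count_space {1..K}) \<Otimes>\<^sub>M (\<Pi>\<^sub>M r\<in>{1..<s}. borel)
            \<rightarrow>\<^sub>M count_space {1..K}"
        and X: "\<forall>\<omega>\<in>space M. X s \<omega> = \<phi> (\<lambda>r\<in>{1..<s}. X r \<omega>, \<lambda>r\<in>{1..<s}. Y r \<omega>)"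
        using rule unfolding assignment_rule_def by blast
      have "\<forall>r\<in>{1..<s}. \<exists>\<zeta>. ?Q r \<zeta>" using less.IH by auto
      then obtain \<zeta> where \<zeta>: "\<And>r. r \<in> {1..<s} \<Longrightarrow> ?Q r (\<zeta> r)" by metis
      \<comment> \<open>Measurability is known on the product over \<open>{1..<r}\<close>.
        Restricting first carries it to \<open>{1..<s}\<close>, and congruence shows that the
        restriction changes no value.\<close>
      have meas: "\<zeta> r \<in> (\<Pi>\<^sub>M r\<in>{1..<s}. borel) \<rightarrow>\<^sub>M count_space {1..K}" if r: "r \<in> {1..<s}" for r
      proof -
        have "(\<lambda>y. \<zeta> r (restrict y {1..<r})) \<in> (\<Pi>\<^sub>M r\<in>{1..<s}. borel) \<rightarrow>\<^sub>M count_space {1..K}"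
          using r \<zeta>[OF r] by (intro measurable_compose[OF measurable_restrict_subset]) auto
        also have "(\<lambda>y. \<zeta> r (restrict y {1..<r})) = \<zeta> r"
        proof
          fix y show "\<zeta> r (restrict y {1..<r}) = \<zeta> r y"
            using \<zeta>[OF r] by (metis restrict_apply')
        qed
        finally show ?thesis .
      qed
      \<comment> \<open>The earlier policies fill the treatment argument of \<phi>; both arguments
        are restricted so as to be points of the product spaces.\<close>
      have "?Q s (\<lambda>y. \<phi> (\<lambda>r\<in>{1..<s}. \<zeta> r y, restrict y {1..<s}))"
      proof (intro conjI ballI allI impI)
        show "(\<lambda>y. \<phi> (\<lambda>r\<in>{1..<s}. \<zeta> r y, restrict y {1..<s}))
            \<in> (\<Pi>\<^sub>M r\<in>{1..<s}. borel) \<rightarrow>\<^sub>M count_space {1..K}"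
          by (intro measurable_compose[OF _ \<phi>] measurable_Pair measurable_restrict meas
              measurable_restrict_subset order_refl)
      next
        fix y y' :: "nat \<Rightarrow> 'y"
        assume y: "\<forall>r\<in>{1..<s}. y r = y' r"
        have "\<zeta> r y = \<zeta> r y'" if r: "r \<in> {1..<s}" for r
        proof -
          have "\<forall>u\<in>{1..<r}. y u = y' u" using y r by auto
          then show ?thesis using \<zeta>[OF r] by blast
        qed
        then have "(\<lambda>r\<in>{1..<s}. \<zeta> r y) = (\<lambda>r\<in>{1..<s}. \<zeta> r y')" by (rule restrict_ext)
        moreover have "restrict y {1..<s} = restrict y' {1..<s}" using y by (intro restrict_ext) auto
        ultimately show "\<phi> (\<lambda>r\<in>{1..<s}. \<zeta> r y, restrict y {1..<s}) =
            \<phi> (\<lambda>r\<in>{1..<s}. \<zeta> r y', restrict y' {1..<s})" by simp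
      next
        fix \<omega> assume \<omega>: "\<omega> \<in> space M"
        have "(\<lambda>r\<in>{1..<s}. X r \<omega>) = (\<lambda>r\<in>{1..<s}. \<zeta> r (\<lambda>r. Y r \<omega>))"
          using \<zeta> \<omega> by (intro restrict_ext) blast
        then show "X s \<omega> = \<phi> (\<lambda>r\<in>{1..<s}. \<zeta> r (\<lambda>r. Y r \<omega>), \<lambda>r\<in>{1..<s}. Y r \<omega>)"
          using X \<omega> by simp
      qed
      then show ?thesis by blast
    qed
  qed
  then have "\<forall>s. \<exists>\<zeta>. 1 \<le> s \<longrightarrow> ?Q s \<zeta>" by blast
  then obtain \<xi> where "\<forall>s. 1 \<le> s \<longrightarrow> ?Q s (\<xi> s)" by (rule choice[THEN exE])
  then show ?thesis by (intro exI[of _ \<xi>]) blast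
qed

text \<open>The normalising total of Bayes' formula cancels. If \<open>d\<close> is 0, positivity of
  the total makes \<open>n\<close> positive and both sides are infinite; otherwise this is real
  arithmetic.\<close>

lemma ennreal_odds_eq:
  fixes n d :: ennreal
  assumes "0 < n + d" "n + d < \<infinity>"
  shows "(n / (n + d)) / (d / (n + d)) = n / d"
proof -
  have fin: "n < top" "d < top" using assms by auto
  then obtain a b where ab: "n = ennreal a" "d = ennreal b" "0 \<le> a" "0 \<le> b"
    by (cases n; cases d) auto
  then have pos: "0 < a + b" using assms by (auto simp: ennreal_plus[symmetric] simp del: ennreal_plus)
  show ?thesis
  proof (cases "b = 0")
    case True
    then have "0 < a" using pos by simp
    with True show ?thesis using ab by (simp add: divide_ennreal ennreal_zero_divide divide_ennreal_def ennreal_mult_top)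
  next
    case False
    then show ?thesis using ab pos
      by (simp add: divide_ennreal ennreal_plus[symmetric] del: ennreal_plus)
  qed
qed

section \<open>The model with treatments as functions of the responses\<close>

text \<open>Fixing one policy \<xi> makes it possible to write all densities as functions of a
  parameter \<open>h\<close> and a response vector \<open>y\<close>.\<close>

locale policy_model = changepoint_model M prior \<mu> K p0 p f g \<eta> \<Theta> X Y
  for M :: "'a measure"
    and prior :: "'h::polish_space measure"
    and \<mu> :: "'y::polish_space measure"
    and K :: nat
    and p0 :: "'h \<Rightarrow> real"
    and p :: "nat \<Rightarrow> 'h \<Rightarrow> (nat \<Rightarrow> nat) \<Rightarrow> real"
    and f g :: "nat \<Rightarrow> 'h \<Rightarrow> 'y \<Rightarrow> real"
    and \<eta> :: "'a \<Rightarrow> 'h"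
    and \<Theta> :: "'a \<Rightarrow> enat"
    and X :: "nat \<Rightarrow> 'a \<Rightarrow> nat"
    and Y :: "nat \<Rightarrow> 'a \<Rightarrow> 'y" +
  fixes \<xi> :: "nat \<Rightarrow> (nat \<Rightarrow> 'y) \<Rightarrow> nat"
  assumes policy_measurable: "1 \<le> s \<Longrightarrow> \<xi> s \<in> (\<Pi>\<^sub>M r\<in>{1..<s}. borel) \<rightarrow>\<^sub>M count_space {1..K}"
    and policy_cong: "1 \<le> s \<Longrightarrow> (\<And>r. r \<in> {1..<s} \<Longrightarrow> y r = y' r) \<Longrightarrow> \<xi> s y = \<xi> s y'"
    and X_policy: "1 \<le> s \<Longrightarrow> \<omega> \<in> space M \<Longrightarrow> X s \<omega> = \<xi> s (\<lambda>r. Y r \<omega>)"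
begin

definition obs :: "nat \<Rightarrow> 'a \<Rightarrow> nat \<Rightarrow> 'y" where
  "obs t \<omega> = (\<lambda>s\<in>{1..t}. Y s \<omega>)"

abbreviation obs_space :: "nat \<Rightarrow> (nat \<Rightarrow> 'y) measure" where
  "obs_space t \<equiv> \<Pi>\<^sub>M s\<in>{1..t}. borel"

abbreviation ref :: "nat \<Rightarrow> (nat \<Rightarrow> 'y) measure" where
  "ref t \<equiv> \<Pi>\<^sub>M s\<in>{1..t}. \<mu>"

text \<open>The definitions for observed quantities are reused with a response vector as sample
  point: \<xi> supplies the treatments, the coordinates supply the responses.\<close>

abbreviation policy_trans :: "nat \<Rightarrow> 'h \<Rightarrow> (nat \<Rightarrow> 'y) \<Rightarrow> real" where
  "policy_trans \<equiv> trans_prob p \<xi>"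

abbreviation D :: "nat \<Rightarrow> 'h \<Rightarrow> (nat \<Rightarrow> 'y) \<Rightarrow> real" where
  "D \<equiv> D_par p0 p f \<xi> (\<lambda>s y. y s)"

text \<open>Total probability over the previous state: either the change has already happened, or it
  happens now with weight \<open>policy_trans\<close>; in both cases the new response has density
  \<open>g\<close>.\<close>

primrec N :: "nat \<Rightarrow> 'h \<Rightarrow> (nat \<Rightarrow> 'y) \<Rightarrow> real" where
  "N 0 h y = p0 h"
| "N (Suc t) h y =
     (N t h y + policy_trans (Suc t) h y * D t h y) * g (\<xi> (Suc t) y) h (y (Suc t))"

lemma D_0: "D 0 h y = 1 - p0 h"
  by (simp add: D_par_def)

lemma D_Suc: "D (Suc t) h y = (1 - policy_trans (Suc t) h y) * D t h y * f (\<xi> (Suc t) y) h (y (Suc t))"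
  by (simp add: D_par_def mult_ac)

declare sets_prior[measurable_cong] sets_mu[measurable_cong]
declare eta_measurable[measurable]

lemma sets_ref[measurable_cong]: "sets (ref t) = sets (obs_space t)"
  by (intro sets_PiM_cong) (auto simp: sets_mu)

lemma space_mu: "space \<mu> = UNIV"
  using sets_eq_imp_space_eq[OF sets_mu] by simp

text \<open>The treatment at time \<open>s\<close> reads responses strictly before \<open>s\<close>,
  so a vector of \<open>t\<close> responses determines the treatments up to
  \<open>Suc t\<close>.\<close>

lemma policy_measurable_obs_space:
  assumes "1 \<le> s" "s \<le> Suc t"
  shows "\<xi> s \<in> obs_space t \<rightarrow>\<^sub>M count_space {1..K}"
proof -
  have "(\<lambda>y. \<xi> s (restrict y {1..<s})) \<in> obs_space t \<rightarrow>\<^sub>M count_space {1..K}"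
    using assms by (intro measurable_compose[OF measurable_restrict_subset policy_measurable]) auto
  also have "(\<lambda>y. \<xi> s (restrict y {1..<s})) = \<xi> s"
    using assms by (intro ext policy_cong) auto
  finally show ?thesis .
qed

lemma policy_range: "1 \<le> s \<Longrightarrow> \<xi> s y \<in> {1..K}"
proof -
  assume s: "1 \<le> s"
  have "\<xi> s (restrict y {1..<s}) \<in> {1..K}"
    using measurable_space[OF policy_measurable[OF s], of "restrict y {1..<s}"] by (simp add: space_PiM)
  also have "\<xi> s (restrict y {1..<s}) = \<xi> s y"
    using s by (intro policy_cong) auto
  finally show ?thesis .
qed

lemma policy_upd: "1 \<le> s \<Longrightarrow> s \<le> Suc t \<Longrightarrow> \<xi> s (y(Suc t := z)) = \<xi> s y"
  by (intro policy_cong) auto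

lemma X_obs: "1 \<le> s \<Longrightarrow> s \<le> Suc t \<Longrightarrow> \<omega> \<in> space M \<Longrightarrow> X s \<omega> = \<xi> s (obs t \<omega>)"
  by (subst X_policy) (auto simp: obs_def intro: policy_cong)

lemma X_range: "1 \<le> s \<Longrightarrow> \<omega> \<in> space M \<Longrightarrow> X s \<omega> \<in> {1..K}"
  using policy_range[of s] by (simp add: X_policy)

lemma Y_obs: "1 \<le> s \<Longrightarrow> s \<le> t \<Longrightarrow> Y s \<omega> = obs t \<omega> s"
  by (simp add: obs_def)

lemma obs_Suc: "obs (Suc t) \<omega> = (obs t \<omega>)(Suc t := Y (Suc t) \<omega>)"
  by (auto simp: obs_def fun_eq_iff)

lemma measurable_obs[measurable]: "obs t \<in> M \<rightarrow>\<^sub>M obs_space t"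
  unfolding obs_def using Y_measurable by (intro measurable_restrict) auto

text \<open>The model assumes measurability of the responses; that of a treatment follows because it
  is a measurable function of \<open>obs s\<close>.\<close>

lemma X_measurable: "1 \<le> s \<Longrightarrow> X s \<in> M \<rightarrow>\<^sub>M count_space UNIV"
proof -
  assume s: "1 \<le> s"
  have "(\<lambda>\<omega>. \<xi> s (obs s \<omega>)) \<in> M \<rightarrow>\<^sub>M count_space {1..K}"
    using s by (intro measurable_compose[OF measurable_obs policy_measurable_obs_space]) auto
  then have "(\<lambda>\<omega>. \<xi> s (obs s \<omega>)) \<in> M \<rightarrow>\<^sub>M count_space UNIV"
    by (rule measurable_compose) simp
  then show ?thesis using X_obs[of s s] s by (subst measurable_cong[where g="\<lambda>\<omega>. \<xi> s (obs s \<omega>)"]) auto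
qed

lemma trans_prob_obs: "s \<le> Suc t \<Longrightarrow> \<omega> \<in> space M \<Longrightarrow> trans_prob p X s h \<omega> = policy_trans s h (obs t \<omega>)"
  unfolding trans_prob_def by (intro arg_cong[where f="p s h"] restrict_ext X_obs) auto

lemma trans_upd: "s \<le> Suc t \<Longrightarrow> policy_trans s h (y(Suc t := z)) = policy_trans s h y"
  unfolding trans_prob_def by (intro arg_cong[where f="p s h"] restrict_ext policy_upd) auto

lemma trans_range: "1 \<le> s \<Longrightarrow> policy_trans s h y \<in> {0..<1}"
  unfolding trans_prob_def by (intro p_range restrict_PiE_iff[THEN iffD2] ballI policy_range) auto

lemma D_obs: "\<omega> \<in> space M \<Longrightarrow> D_par p0 p f X Y t h \<omega> = D t h (obs t \<omega>)"
  unfolding D_par_def by (auto intro!: prod.cong simp: trans_prob_obs[where t=t] X_obs[where t=t] Y_obs[where t=t])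

lemma D_upd: "D t h (y(Suc t := z)) = D t h y"
  unfolding D_par_def by (auto intro!: prod.cong simp: trans_upd policy_upd)

text \<open>Agreement on \<open>{1..t}\<close> is a form that passes through the induction;
  invariance under an update at \<open>Suc t\<close> alone, as in \<open>N_upd\<close>, is tied to
  one index and does not.\<close>

lemma N_cong: "(\<And>r. r \<in> {1..t} \<Longrightarrow> y r = y' r) \<Longrightarrow> N t h y = N t h y'"
proof (induction t)
  case (Suc t)
  have "\<xi> s y = \<xi> s y'" if "s \<in> {1..Suc t}" for s using that Suc.prems by (intro policy_cong) auto
  moreover from this have "policy_trans s h y = policy_trans s h y'" if "s \<in> {1..Suc t}" for s
    unfolding trans_prob_def using that by (intro arg_cong[where f="p s h"] restrict_ext) auto
  moreover from calculation have "D t h y = D t h y'"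
    unfolding D_par_def using Suc.prems by (auto intro!: prod.cong)
  ultimately show ?case using Suc by simp
qed simp

lemma N_upd: "N t h (y(Suc t := z)) = N t h y"
  by (rule N_cong) auto

lemma D_nonneg: "0 \<le> D t h y"
  unfolding D_par_def using p0_range[of h] trans_range[of _ h y] f_nonneg[OF policy_range]
  by (intro mult_nonneg_nonneg prod_nonneg ballI) (auto simp: less_imp_le)

lemma N_nonneg: "0 \<le> N t h y"
proof (induction t)
  case (Suc t)
  then show ?case
    using trans_range[of "Suc t" h y] D_nonneg[of t h y] g_nonneg[OF policy_range, of "Suc t" y h "y (Suc t)"]
    by auto
qed (use p0_range in \<open>auto simp: less_imp_le\<close>)

text \<open>The vector of treatments takes finitely many values, and for each fixed value
  \<open>p\<close> is measurable in the parameter; a countable case distinction then gives joint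
  measurability.\<close>

lemma measurable_trans:
  assumes s: "1 \<le> s" "s \<le> Suc t"
  shows "(\<lambda>(h, y). policy_trans s h y) \<in> borel_measurable (borel \<Otimes>\<^sub>M obs_space t)"
proof -
  have "(\<lambda>z. \<lambda>r\<in>{1..s}. \<xi> r (snd z)) \<in> (borel :: 'h measure) \<Otimes>\<^sub>M obs_space t \<rightarrow>\<^sub>M (\<Pi>\<^sub>M r\<in>{1..s}. count_space {1..K})"
    using s by (intro measurable_restrict measurable_compose[OF measurable_snd policy_measurable_obs_space]) auto
  then have vec: "(\<lambda>z. \<lambda>r\<in>{1..s}. \<xi> r (snd z)) \<in> (borel :: 'h measure) \<Otimes>\<^sub>M obs_space t \<rightarrow>\<^sub>M count_space ({1..s} \<rightarrow>\<^sub>E {1..K})"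
    by (subst (asm) count_space_PiM_finite) auto
  have "(\<lambda>z. p s (fst z) (\<lambda>r\<in>{1..s}. \<xi> r (snd z))) \<in> borel_measurable (borel \<Otimes>\<^sub>M obs_space t)"
  proof (rule measurable_compose_countable'[OF _ vec])
    show "(\<lambda>z. p s (fst z) x) \<in> borel_measurable ((borel :: 'h measure) \<Otimes>\<^sub>M obs_space t)"
      if "x \<in> {1..s} \<rightarrow>\<^sub>E {1..K}" for x
      by (rule measurable_compose[OF measurable_fst p_measurable[OF s(1) that]])
  qed (simp add: countable_finite finite_PiE)
  then show ?thesis by (simp add: trans_prob_def case_prod_beta)
qed

lemma measurable_response_density:
  assumes q: "\<And>x. x \<in> {1..K} \<Longrightarrow> (\<lambda>(h, y). q x h y) \<in> borel_measurable (borel \<Otimes>\<^sub>M borel)"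
    and h: "h \<in> A \<rightarrow>\<^sub>M (borel :: 'h measure)" and y: "y \<in> A \<rightarrow>\<^sub>M obs_space t" and z: "z \<in> A \<rightarrow>\<^sub>M (borel :: 'y measure)"
    and s: "1 \<le> s" "s \<le> Suc t"
  shows "(\<lambda>a. q (\<xi> s (y a)) (h a) (z a) :: real) \<in> borel_measurable A"
proof (rule measurable_compose_countable'[where I="{1..K}"])
  show "(\<lambda>a. \<xi> s (y a)) \<in> A \<rightarrow>\<^sub>M count_space {1..K}"
    by (rule measurable_compose[OF y policy_measurable_obs_space[OF s]])
  show "(\<lambda>a. q x (h a) (z a)) \<in> borel_measurable A" if "x \<in> {1..K}" for x
    using measurable_compose[OF measurable_Pair[OF h z] q[OF that]] by simp
qed simp

text \<open>The product space stays fixed at \<open>t\<close> while the induction runs over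
  \<open>s\<close>.\<close>

lemma measurable_D: "s \<le> t \<Longrightarrow> (\<lambda>(h, y). D s h y) \<in> borel_measurable (borel \<Otimes>\<^sub>M obs_space t)"
proof (induction s)
  case 0
  show ?case using p0_measurable by (simp add: D_0 case_prod_beta)
next
  case (Suc s)
  have "(\<lambda>a. f (\<xi> (Suc s) (snd a)) (fst a) (snd a (Suc s))) \<in> borel_measurable ((borel :: 'h measure) \<Otimes>\<^sub>M obs_space t)"
    using Suc.prems by (intro measurable_response_density[where t=t] f_measurable) auto
  moreover have "(\<lambda>a. D s (fst a) (snd a)) \<in> borel_measurable (borel \<Otimes>\<^sub>M obs_space t)"
    using Suc by (simp add: case_prod_beta)
  moreover have "(\<lambda>a. policy_trans (Suc s) (fst a) (snd a)) \<in> borel_measurable (borel \<Otimes>\<^sub>M obs_space t)"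
    using measurable_trans[of "Suc s" t] Suc.prems by (simp add: case_prod_beta)
  ultimately show ?case unfolding D_Suc case_prod_beta by measurable
qed

lemma measurable_N: "s \<le> t \<Longrightarrow> (\<lambda>(h, y). N s h y) \<in> borel_measurable (borel \<Otimes>\<^sub>M obs_space t)"
proof (induction s)
  case 0
  show ?case using p0_measurable by (simp add: case_prod_beta)
next
  case (Suc s)
  have "(\<lambda>a. g (\<xi> (Suc s) (snd a)) (fst a) (snd a (Suc s))) \<in> borel_measurable ((borel :: 'h measure) \<Otimes>\<^sub>M obs_space t)"
    using Suc.prems by (intro measurable_response_density[where t=t] g_measurable) auto
  moreover have "(\<lambda>a. D s (fst a) (snd a)) \<in> borel_measurable (borel \<Otimes>\<^sub>M obs_space t)"
    using measurable_D[of s t] Suc.prems by (simp add: case_prod_beta)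
  moreover have "(\<lambda>a. N s (fst a) (snd a)) \<in> borel_measurable (borel \<Otimes>\<^sub>M obs_space t)"
    using Suc by (simp add: case_prod_beta)
  moreover have "(\<lambda>a. policy_trans (Suc s) (fst a) (snd a)) \<in> borel_measurable (borel \<Otimes>\<^sub>M obs_space t)"
    using measurable_trans[of "Suc s" t] Suc.prems by (simp add: case_prod_beta)
  ultimately show ?case unfolding N.simps case_prod_beta by measurable
qed

section \<open>The observation filtration in terms of the response vector\<close>

lemma subalgebra_filtration: "subalgebra M (obs_filtration M X Y t)"
  by (rule subalgebra_obs_filtration[OF X_measurable Y_measurable])

lemma Y_measurable_filtration: "1 \<le> s \<Longrightarrow> s \<le> t \<Longrightarrow> Y s \<in> obs_filtration M X Y (enat t) \<rightarrow>\<^sub>M borel"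
  unfolding obs_filtration_def
  by (intro measurable_sigma_events_of UN_least Un_least events_of_subset_Pow) auto

lemma obs_measurable_filtration: "obs t \<in> obs_filtration M X Y (enat t) \<rightarrow>\<^sub>M obs_space t"
  unfolding obs_def using Y_measurable_filtration by (intro measurable_restrict) auto

text \<open>Treatments are functions of responses, so the \<sigma>-algebra generated by
  \<open>obs t\<close> contains every generator of the filtration. Hence integrals over filtration
  events become integrals over response vectors.\<close>

lemma sets_filtration_obs:
  assumes "A \<in> sets (obs_filtration M X Y (enat t))"
  obtains C where "C \<in> sets (obs_space t)" "A = obs t -` C \<inter> space M"
proof -
  let ?V = "vimage_algebra (space M) (obs t) (obs_space t)"
  have obs: "obs t \<in> space M \<rightarrow> space (obs_space t)"
    using measurable_space[OF measurable_obs] by auto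
  have obs_V: "obs t \<in> ?V \<rightarrow>\<^sub>M obs_space t" by (rule measurable_vimage_algebra1[OF obs])
  have "events_of M (count_space UNIV) (X s) \<union> events_of M borel (Y s) \<subseteq> sets ?V" if s: "1 \<le> s" "s \<le> t" for s
  proof -
    have "(\<lambda>\<omega>. \<xi> s (obs t \<omega>)) \<in> ?V \<rightarrow>\<^sub>M count_space {1..K}"
      using s by (intro measurable_compose[OF obs_V policy_measurable_obs_space]) auto
    then have "(\<lambda>\<omega>. \<xi> s (obs t \<omega>)) \<in> ?V \<rightarrow>\<^sub>M count_space UNIV"
      by (rule measurable_compose) simp
    then have "X s \<in> ?V \<rightarrow>\<^sub>M count_space UNIV"
      using X_obs[of s t] s by (subst measurable_cong[where g="\<lambda>\<omega>. \<xi> s (obs t \<omega>)"]) auto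
    moreover have "(\<lambda>\<omega>. obs t \<omega> s) \<in> ?V \<rightarrow>\<^sub>M borel"
      using s by (intro measurable_compose[OF obs_V measurable_component_singleton]) auto
    then have "Y s \<in> ?V \<rightarrow>\<^sub>M borel"
      using Y_obs[OF s] by (simp add: ext[of "Y s" "\<lambda>\<omega>. obs t \<omega> s"])
    ultimately show ?thesis by (intro Un_least events_of_subset_sets) auto
  qed
  then have "subalgebra ?V (sigma (space ?V) (\<Union>s\<in>{s. 1 \<le> s \<and> enat s \<le> enat t}.
      events_of M (count_space UNIV) (X s) \<union> events_of M borel (Y s)))"
    by (intro subalgebra_sigma UN_least) simp
  then have "sets (obs_filtration M X Y (enat t)) \<subseteq> sets ?V"
    by (simp add: subalgebra_def obs_filtration_def)
  with assms have "A \<in> sets ?V" by auto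
  then show thesis using that unfolding sets_vimage_algebra2[OF obs] by blast
qed

section \<open>Joint density of parameter and responses\<close>

abbreviation L :: "nat \<Rightarrow> 'a \<Rightarrow> nat" where "L \<equiv> latent \<Theta>"

lemma pred_L: "Measurable.pred M (\<lambda>\<omega>. L t \<omega> = i)"
  by (rule pred_latent_eq[OF Theta_measurable])

lemma borel_measurable_indicator_L: "(\<lambda>\<omega>. indicator {\<omega>. L t \<omega> = i} \<omega> :: ennreal) \<in> borel_measurable M"
  using pred_L by (intro borel_measurable_indicator') (simp add: Measurable.pred_def)

abbreviation trans_algebra :: "nat \<Rightarrow> 'a measure" where
  "trans_algebra t \<equiv> sigma (space M) (events_of M borel \<eta>
     \<union> events_of M (count_space UNIV) (L (t - 1))
     \<union> sets (obs_filtration M X Y (enat (t - 1)))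
     \<union> events_of M (count_space UNIV) (X t))"

abbreviation response_algebra :: "nat \<Rightarrow> 'a measure" where
  "response_algebra t \<equiv> sigma (space M) (events_of M borel \<eta>
     \<union> (\<Union>s\<in>{0..t}. events_of M (count_space UNIV) (L s))
     \<union> sets (obs_filtration M X Y (enat (t - 1)))
     \<union> events_of M (count_space UNIV) (X t))"

lemma sets_filtration: "sets (obs_filtration M X Y t) \<subseteq> sets M"
  and space_filtration: "space (obs_filtration M X Y t) = space M"
  using subalgebra_filtration by (auto simp: subalgebra_def)

lemma sets_filtration_Pow: "sets (obs_filtration M X Y t) \<subseteq> Pow (space M)"
  using sets.space_closed[of "obs_filtration M X Y t"] by (simp add: space_filtration)

text \<open>Provides the admissible test functions for the transition law: functions of the
  parameter, the responses up to \<open>t - 1\<close> and the previous state.\<close>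

lemma trans_algebra:
  assumes "1 \<le> t"
  shows "subalgebra M (trans_algebra t)"
    and "(\<lambda>\<omega>. (\<eta> \<omega>, obs (t - 1) \<omega>)) \<in> trans_algebra t \<rightarrow>\<^sub>M borel \<Otimes>\<^sub>M obs_space (t - 1)"
    and "L (t - 1) \<in> trans_algebra t \<rightarrow>\<^sub>M count_space UNIV"
proof -
  let ?G = "events_of M borel \<eta> \<union> events_of M (count_space UNIV) (L (t - 1))
     \<union> sets (obs_filtration M X Y (enat (t - 1))) \<union> events_of M (count_space UNIV) (X t)"
  have Pow: "?G \<subseteq> Pow (space M)"
    by (intro Un_least events_of_subset_Pow sets_filtration_Pow)
  show "subalgebra M (trans_algebra t)"
    using assms by (intro subalgebra_sigma Un_least events_of_subset_sets sets_filtration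
        measurable_latent[OF Theta_measurable] X_measurable eta_measurable) auto
  show "L (t - 1) \<in> trans_algebra t \<rightarrow>\<^sub>M count_space UNIV"
    by (intro measurable_sigma_events_of[OF Pow]) auto
  have "\<eta> \<in> trans_algebra t \<rightarrow>\<^sub>M borel"
    by (intro measurable_sigma_events_of[OF Pow]) auto
  moreover have "obs (t - 1) \<in> trans_algebra t \<rightarrow>\<^sub>M obs_space (t - 1)"
  proof (rule measurable_from_subalg[OF _ obs_measurable_filtration])
    show "subalgebra (trans_algebra t) (obs_filtration M X Y (enat (t - 1)))"
      unfolding subalgebra_def using Pow by (auto simp: space_filtration space_measure_of_conv)
  qed
  ultimately show "(\<lambda>\<omega>. (\<eta> \<omega>, obs (t - 1) \<omega>)) \<in> trans_algebra t \<rightarrow>\<^sub>M borel \<Otimes>\<^sub>M obs_space (t - 1)"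
    by (rule measurable_Pair)
qed

lemma response_algebra:
  assumes "1 \<le> t"
  shows "subalgebra M (response_algebra t)"
    and "(\<lambda>\<omega>. (\<eta> \<omega>, obs (t - 1) \<omega>)) \<in> response_algebra t \<rightarrow>\<^sub>M borel \<Otimes>\<^sub>M obs_space (t - 1)"
    and "L t \<in> response_algebra t \<rightarrow>\<^sub>M count_space UNIV"
proof -
  let ?G = "events_of M borel \<eta> \<union> (\<Union>s\<in>{0..t}. events_of M (count_space UNIV) (L s))
     \<union> sets (obs_filtration M X Y (enat (t - 1))) \<union> events_of M (count_space UNIV) (X t)"
  have Pow: "?G \<subseteq> Pow (space M)"
    by (intro Un_least UN_least events_of_subset_Pow sets_filtration_Pow)
  show "subalgebra M (response_algebra t)"
    using assms by (intro subalgebra_sigma Un_least UN_least events_of_subset_sets sets_filtration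
        measurable_latent[OF Theta_measurable] X_measurable eta_measurable) auto
  show "L t \<in> response_algebra t \<rightarrow>\<^sub>M count_space UNIV"
    by (intro measurable_sigma_events_of[OF Pow]) auto
  have "\<eta> \<in> response_algebra t \<rightarrow>\<^sub>M borel"
    by (intro measurable_sigma_events_of[OF Pow]) auto
  moreover have "obs (t - 1) \<in> response_algebra t \<rightarrow>\<^sub>M obs_space (t - 1)"
  proof (rule measurable_from_subalg[OF _ obs_measurable_filtration])
    show "subalgebra (response_algebra t) (obs_filtration M X Y (enat (t - 1)))"
      unfolding subalgebra_def using Pow by (auto simp: space_filtration space_measure_of_conv)
  qed
  ultimately show "(\<lambda>\<omega>. (\<eta> \<omega>, obs (t - 1) \<omega>)) \<in> response_algebra t \<rightarrow>\<^sub>M borel \<Otimes>\<^sub>M obs_space (t - 1)"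
    by (rule measurable_Pair)
qed

text \<open>Says that the law of parameter and responses, restricted to \<open>P\<close>, has
  density \<open>w\<close> with respect to \<open>prior \<Otimes>\<^sub>M ref t\<close>. Test
  functions are used instead of sets because the steps of the induction absorb their factors into
  \<open>F\<close>.\<close>

definition joint_density :: "nat \<Rightarrow> ('a \<Rightarrow> bool) \<Rightarrow> ('h \<Rightarrow> (nat \<Rightarrow> 'y) \<Rightarrow> real) \<Rightarrow> bool" where
  "joint_density t P w \<longleftrightarrow> (\<forall>F \<in> borel_measurable (borel \<Otimes>\<^sub>M obs_space t).
     (\<integral>\<^sup>+\<omega>. F (\<eta> \<omega>, obs t \<omega>) * indicator {\<omega>. P \<omega>} \<omega> \<partial>M) =
     (\<integral>\<^sup>+z. F z * ennreal (w (fst z) (snd z)) \<partial>(prior \<Otimes>\<^sub>M ref t)))"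

lemma joint_densityD:
  "joint_density t P w \<Longrightarrow> F \<in> borel_measurable (borel \<Otimes>\<^sub>M obs_space t) \<Longrightarrow>
     (\<integral>\<^sup>+\<omega>. F (\<eta> \<omega>, obs t \<omega>) * indicator {\<omega>. P \<omega>} \<omega> \<partial>M) =
     (\<integral>\<^sup>+z. F z * ennreal (w (fst z) (snd z)) \<partial>(prior \<Otimes>\<^sub>M ref t))"
  by (simp add: joint_density_def)

lemma measurable_eta_obs[measurable]: "(\<lambda>\<omega>. (\<eta> \<omega>, obs t \<omega>)) \<in> M \<rightarrow>\<^sub>M borel \<Otimes>\<^sub>M obs_space t"
  by measurable

sublocale mu_product: product_sigma_finite "\<lambda>_::nat. \<mu>"
  by unfold_locales

lemma sigma_finite_ref: "sigma_finite_measure (ref t)"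
  by (rule mu_product.sigma_finite) simp

lemma initial_algebra:
  "subalgebra M (sigma (space M) (events_of M borel \<eta>))"
  "\<eta> \<in> sigma (space M) (events_of M borel \<eta>) \<rightarrow>\<^sub>M borel"
  by (intro subalgebra_sigma events_of_subset_sets eta_measurable refl)
     (intro measurable_sigma_events_of events_of_subset_Pow; simp)

text \<open>Over the empty index set \<open>ref 0\<close> is the unit mass at
  \<open>\<lambda>_. undefined\<close>, so integrating over \<open>y\<close> is evaluation there.
  What remains is the law of \<eta>.\<close>

lemma joint_density_initial:
  assumes P: "Measurable.pred M P" and q: "q \<in> borel_measurable borel"
    and law: "AE \<omega> in M. cond_prob_given M (sigma (space M) (events_of M borel \<eta>)) P \<omega> = q (\<eta> \<omega>)"
  shows "joint_density 0 P (\<lambda>h y. q h)"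
  unfolding joint_density_def
proof
  fix F :: "'h \<times> (nat \<Rightarrow> 'y) \<Rightarrow> ennreal"
  assume F: "F \<in> borel_measurable (borel \<Otimes>\<^sub>M obs_space 0)"
  interpret R: sigma_finite_measure "ref 0" by (rule sigma_finite_ref)
  have F': "(\<lambda>h. F (h, \<lambda>_. undefined)) \<in> borel_measurable borel"
    by (rule measurable_compose[OF _ F]) (simp add: space_PiM)
  have obs_0: "obs 0 \<omega> = (\<lambda>_. undefined)" for \<omega> by (auto simp: obs_def)
  have "(\<integral>\<^sup>+\<omega>. F (\<eta> \<omega>, obs 0 \<omega>) * indicator {\<omega>. P \<omega>} \<omega> \<partial>M)
      = (\<integral>\<^sup>+\<omega>. F (\<eta> \<omega>, \<lambda>_. undefined) * ennreal (q (\<eta> \<omega>)) \<partial>M)"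
    unfolding obs_0
    by (rule nn_integral_cond_prob_given[OF initial_algebra(1) P
          measurable_compose[OF initial_algebra(2) F'], where R="\<lambda>_. True"]) (use law in auto)
  also have "\<dots> = (\<integral>\<^sup>+h. F (h, \<lambda>_. undefined) * ennreal (q h) \<partial>distr M borel \<eta>)"
    using F' q by (subst nn_integral_distr) auto
  also have "\<dots> = (\<integral>\<^sup>+h. \<integral>\<^sup>+y. F (h, y) * ennreal (q h) \<partial>ref 0 \<partial>prior)"
    unfolding eta_law using mu_product.nn_integral_empty by simp
  also have "\<dots> = (\<integral>\<^sup>+z. F z * ennreal (q (fst z)) \<partial>(prior \<Otimes>\<^sub>M ref 0))"
    using F q by (subst R.nn_integral_fst[symmetric]) auto
  finally show "(\<integral>\<^sup>+\<omega>. F (\<eta> \<omega>, obs 0 \<omega>) * indicator {\<omega>. P \<omega>} \<omega> \<partial>M)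
      = (\<integral>\<^sup>+z. F z * ennreal (q (fst z)) \<partial>(prior \<Otimes>\<^sub>M ref 0))" .
qed

section \<open>The latent transition\<close>

lemma transition_complement:
  assumes "1 \<le> t"
  shows "AE \<omega> in M. L (t - 1) \<omega> = 0 \<longrightarrow>
    cond_prob_given M (trans_algebra t) (\<lambda>\<omega>. L t \<omega> = 0) \<omega> = 1 - trans_prob p X t (\<eta> \<omega>) \<omega>"
proof -
  have "AE \<omega> in M. cond_prob_given M (trans_algebra t) (\<lambda>\<omega>. \<not> L t \<omega> = 1) \<omega>
      = 1 - cond_prob_given M (trans_algebra t) (\<lambda>\<omega>. L t \<omega> = 1) \<omega>"
    by (rule cond_prob_given_not[OF trans_algebra(1)[OF assms] pred_L])
  with transition_law[OF assms] show ?thesis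
    unfolding latent_eq_1_iff not_not by eventually_elim simp
qed

text \<open>The indicator of \<open>L t \<omega> = 0\<close> confines the test function to the event
  where the transition law is known; the resulting weight \<open>q\<close> is then absorbed into
  \<open>F\<close>. The cases are \<open>q = 1 - policy_trans\<close> for the new state 0 and
  \<open>q = policy_trans\<close> for the new state 1.\<close>

lemma joint_density_transition_aux:
  assumes D: "joint_density t (\<lambda>\<omega>. L t \<omega> = 0) (D t)"
    and law: "AE \<omega> in M. L t \<omega> = 0 \<longrightarrow>
      cond_prob_given M (trans_algebra (Suc t)) (\<lambda>\<omega>. L (Suc t) \<omega> = i) \<omega> = q (\<eta> \<omega>) (obs t \<omega>)"
    and q: "(\<lambda>(h, y). q h y) \<in> borel_measurable (borel \<Otimes>\<^sub>M obs_space t)" and q0: "\<And>h y. 0 \<le> q h y"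
    and F: "F \<in> borel_measurable (borel \<Otimes>\<^sub>M obs_space t)"
  shows "(\<integral>\<^sup>+\<omega>. F (\<eta> \<omega>, obs t \<omega>) * indicator {\<omega>. L t \<omega> = 0} \<omega> * indicator {\<omega>. L (Suc t) \<omega> = i} \<omega> \<partial>M)
    = (\<integral>\<^sup>+z. F z * ennreal (q (fst z) (snd z) * D t (fst z) (snd z)) \<partial>(prior \<Otimes>\<^sub>M ref t))"
proof -
  have "1 \<le> Suc t" by simp
  note G = trans_algebra[OF this, unfolded diff_Suc_1]
  have "Measurable.pred (trans_algebra (Suc t)) (\<lambda>\<omega>. L t \<omega> = 0)"
    using G(3) by (intro pred_eq_const1) auto
  then have ind: "(\<lambda>\<omega>. indicator {\<omega>. L t \<omega> = 0} \<omega> :: ennreal) \<in> borel_measurable (trans_algebra (Suc t))"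
    by (intro borel_measurable_indicator') (simp add: Measurable.pred_def)
  have "(\<integral>\<^sup>+\<omega>. F (\<eta> \<omega>, obs t \<omega>) * indicator {\<omega>. L t \<omega> = 0} \<omega> * indicator {\<omega>. L (Suc t) \<omega> = i} \<omega> \<partial>M)
      = (\<integral>\<^sup>+\<omega>. F (\<eta> \<omega>, obs t \<omega>) * indicator {\<omega>. L t \<omega> = 0} \<omega> * ennreal (q (\<eta> \<omega>) (obs t \<omega>)) \<partial>M)"
  proof (rule nn_integral_cond_prob_given[OF _ pred_L _ law])
    show "subalgebra M (trans_algebra (Suc t))" by (rule trans_algebra) simp
    show "(\<lambda>\<omega>. F (\<eta> \<omega>, obs t \<omega>) * indicator {\<omega>. L t \<omega> = 0} \<omega>) \<in> borel_measurable (trans_algebra (Suc t))"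
      using measurable_compose[OF G(2) F] ind by simp
  qed simp
  also have "\<dots> = (\<integral>\<^sup>+\<omega>. (\<lambda>z. F z * ennreal (q (fst z) (snd z))) (\<eta> \<omega>, obs t \<omega>) * indicator {\<omega>. L t \<omega> = 0} \<omega> \<partial>M)"
    by (simp add: mult_ac)
  also have "\<dots> = (\<integral>\<^sup>+z. F z * ennreal (q (fst z) (snd z)) * ennreal (D t (fst z) (snd z)) \<partial>(prior \<Otimes>\<^sub>M ref t))"
    by (rule joint_densityD[OF D]) (use F q in \<open>simp add: case_prod_beta\<close>)
  also have "\<dots> = (\<integral>\<^sup>+z. F z * ennreal (q (fst z) (snd z) * D t (fst z) (snd z)) \<partial>(prior \<Otimes>\<^sub>M ref t))"
    by (simp add: ennreal_mult q0 D_nonneg mult.assoc)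
  finally show ?thesis .
qed

text \<open>These are the densities between the transition to \<open>Suc t\<close> and the response
  at \<open>Suc t\<close>. State 0 at \<open>Suc t\<close> forces state 0 at \<open>t\<close>, while
  state 1 splits into a change by time \<open>t\<close> and a change exactly at
  \<open>Suc t\<close>.\<close>

lemma joint_density_transition:
  assumes D: "joint_density t (\<lambda>\<omega>. L t \<omega> = 0) (D t)" and N: "joint_density t (\<lambda>\<omega>. L t \<omega> = 1) (N t)"
  shows "joint_density t (\<lambda>\<omega>. L (Suc t) \<omega> = 0) (\<lambda>h y. (1 - policy_trans (Suc t) h y) * D t h y)"
    and "joint_density t (\<lambda>\<omega>. L (Suc t) \<omega> = 1) (\<lambda>h y. N t h y + policy_trans (Suc t) h y * D t h y)"
proof -
  have one: "1 \<le> Suc t" by simp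
  have tr: "(\<lambda>(h, y). policy_trans (Suc t) h y) \<in> borel_measurable (borel \<Otimes>\<^sub>M obs_space t)"
    by (rule measurable_trans) auto
  have law0: "AE \<omega> in M. L t \<omega> = 0 \<longrightarrow>
      cond_prob_given M (trans_algebra (Suc t)) (\<lambda>\<omega>. L (Suc t) \<omega> = 0) \<omega> = 1 - policy_trans (Suc t) (\<eta> \<omega>) (obs t \<omega>)"
    using transition_complement[OF one, unfolded diff_Suc_1] AE_space unfolding diff_Suc_1
    by eventually_elim (simp add: trans_prob_obs[where t=t])
  have law1: "AE \<omega> in M. L t \<omega> = 0 \<longrightarrow>
      cond_prob_given M (trans_algebra (Suc t)) (\<lambda>\<omega>. L (Suc t) \<omega> = 1) \<omega> = policy_trans (Suc t) (\<eta> \<omega>) (obs t \<omega>)"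
    using transition_law[OF one, unfolded diff_Suc_1] AE_space unfolding diff_Suc_1
    by eventually_elim (simp add: trans_prob_obs[where t=t])
  have L_mono: "L (Suc t) \<omega> = 0 \<Longrightarrow> L t \<omega> = 0" for \<omega>
    by (auto simp: latent_def split: if_splits dest: Suc_ile_eq[THEN iffD1, OF less_imp_le])
  show "joint_density t (\<lambda>\<omega>. L (Suc t) \<omega> = 0) (\<lambda>h y. (1 - policy_trans (Suc t) h y) * D t h y)"
    unfolding joint_density_def
  proof
    fix F :: "'h \<times> (nat \<Rightarrow> 'y) \<Rightarrow> ennreal"
    assume F: "F \<in> borel_measurable (borel \<Otimes>\<^sub>M obs_space t)"
    have "(\<integral>\<^sup>+\<omega>. F (\<eta> \<omega>, obs t \<omega>) * indicator {\<omega>. L (Suc t) \<omega> = 0} \<omega> \<partial>M)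
      = (\<integral>\<^sup>+\<omega>. F (\<eta> \<omega>, obs t \<omega>) * indicator {\<omega>. L t \<omega> = 0} \<omega> * indicator {\<omega>. L (Suc t) \<omega> = 0} \<omega> \<partial>M)"
      by (rule nn_integral_cong) (auto split: split_indicator dest: L_mono)
    also have "\<dots> = (\<integral>\<^sup>+z. F z * ennreal ((1 - policy_trans (Suc t) (fst z) (snd z)) * D t (fst z) (snd z)) \<partial>(prior \<Otimes>\<^sub>M ref t))"
      by (rule joint_density_transition_aux[OF D law0 _ _ F])
        (use tr trans_range[of "Suc t"] in \<open>auto simp: case_prod_beta less_imp_le\<close>)
    finally show "(\<integral>\<^sup>+\<omega>. F (\<eta> \<omega>, obs t \<omega>) * indicator {\<omega>. L (Suc t) \<omega> = 0} \<omega> \<partial>M) = \<dots>" .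
  qed
  show "joint_density t (\<lambda>\<omega>. L (Suc t) \<omega> = 1) (\<lambda>h y. N t h y + policy_trans (Suc t) h y * D t h y)"
    unfolding joint_density_def
  proof
    fix F :: "'h \<times> (nat \<Rightarrow> 'y) \<Rightarrow> ennreal"
    assume F: "F \<in> borel_measurable (borel \<Otimes>\<^sub>M obs_space t)"
    note m = measurable_compose[OF measurable_eta_obs F] borel_measurable_indicator_L
    have "(\<integral>\<^sup>+\<omega>. F (\<eta> \<omega>, obs t \<omega>) * indicator {\<omega>. L (Suc t) \<omega> = 1} \<omega> \<partial>M)
      = (\<integral>\<^sup>+\<omega>. F (\<eta> \<omega>, obs t \<omega>) * indicator {\<omega>. L t \<omega> = 1} \<omega> +
         F (\<eta> \<omega>, obs t \<omega>) * indicator {\<omega>. L t \<omega> = 0} \<omega> * indicator {\<omega>. L (Suc t) \<omega> = 1} \<omega> \<partial>M)"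
      unfolding latent_eq_1_iff
      by (rule nn_integral_cong) (auto split: split_indicator dest: L_mono)
    also have "\<dots> = (\<integral>\<^sup>+\<omega>. F (\<eta> \<omega>, obs t \<omega>) * indicator {\<omega>. L t \<omega> = 1} \<omega> \<partial>M) +
        (\<integral>\<^sup>+\<omega>. F (\<eta> \<omega>, obs t \<omega>) * indicator {\<omega>. L t \<omega> = 0} \<omega> * indicator {\<omega>. L (Suc t) \<omega> = 1} \<omega> \<partial>M)"
      by (intro nn_integral_add borel_measurable_times_ennreal m)
    also have "\<dots> = (\<integral>\<^sup>+z. F z * ennreal (N t (fst z) (snd z)) \<partial>(prior \<Otimes>\<^sub>M ref t)) +
        (\<integral>\<^sup>+z. F z * ennreal (policy_trans (Suc t) (fst z) (snd z) * D t (fst z) (snd z)) \<partial>(prior \<Otimes>\<^sub>M ref t))"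
      by (subst joint_densityD[OF N F], subst joint_density_transition_aux[OF D law1 tr _ F])
        (use trans_range[of "Suc t"] in auto)
    also have "\<dots> = (\<integral>\<^sup>+z. F z * ennreal (N t (fst z) (snd z)) +
        F z * ennreal (policy_trans (Suc t) (fst z) (snd z) * D t (fst z) (snd z)) \<partial>(prior \<Otimes>\<^sub>M ref t))"
      using F tr measurable_N[of t t] measurable_D[of t t]
      by (intro nn_integral_add[symmetric]) (simp_all add: case_prod_beta)
    also have "\<dots> = (\<integral>\<^sup>+z. F z * ennreal (N t (fst z) (snd z) + policy_trans (Suc t) (fst z) (snd z) * D t (fst z) (snd z)) \<partial>(prior \<Otimes>\<^sub>M ref t))"
      using trans_range[of "Suc t"]
      by (intro nn_integral_cong) (subst ennreal_plus; simp add: N_nonneg D_nonneg distrib_left)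
    finally show "(\<integral>\<^sup>+\<omega>. F (\<eta> \<omega>, obs t \<omega>) * indicator {\<omega>. L (Suc t) \<omega> = 1} \<omega> \<partial>M) = \<dots>" .
  qed
qed

\<comment> \<open>keeps the index sets \<open>{1..t}\<close> of the product measures syntactically fixed\<close>
declare One_nat_def [simp del]

section \<open>The response step\<close>

text \<open>Indexing the two densities by the latent state allows one proof of the response step for
  both states.\<close>

definition response_density :: "nat \<Rightarrow> nat \<Rightarrow> 'h \<Rightarrow> 'y \<Rightarrow> real" where
  "response_density i = (if i = 0 then f else g)"

lemma response_density:
  assumes "x \<in> {1..K}"
  shows "(\<lambda>(h, y). response_density i x h y) \<in> borel_measurable (borel \<Otimes>\<^sub>M borel)"
    and "0 \<le> response_density i x h y"
    and "(\<integral>\<^sup>+y. ennreal (response_density i x h y) \<partial>\<mu>) = 1"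
  using assms f_measurable g_measurable f_nonneg g_nonneg f_density g_density
  by (auto simp: response_density_def)

lemma response_density_measurable2:
  assumes "x \<in> {1..K}"
  shows "response_density i x h \<in> borel_measurable \<mu>"
  using measurable_compose[OF measurable_Pair1' response_density(1)[OF assms], of h] by simp

text \<open>The response law is stated with the real-valued \<open>measure\<close>; since the
  density integrates to 1, the passage back to \<open>ennreal\<close> loses nothing.\<close>

lemma ennreal_measure_response:
  assumes x: "x \<in> {1..K}" and B: "B \<in> sets borel"
  shows "ennreal (measure (density \<mu> (\<lambda>y. ennreal (response_density i x h y))) B)
    = (\<integral>\<^sup>+y. ennreal (response_density i x h y) * indicator B y \<partial>\<mu>)"
proof -
  let ?d = "density \<mu> (\<lambda>y. ennreal (response_density i x h y))"
  note m = response_density_measurable2[OF x, of i h]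
  have "emeasure ?d (space ?d) = 1"
    using m by (subst emeasure_density) (auto simp: response_density(3)[OF x] nn_integral_set_ennreal[symmetric] cong: nn_integral_cong)
  then interpret d: prob_space ?d by (rule prob_spaceI)
  show ?thesis
    using m B by (subst d.emeasure_eq_measure[symmetric], subst emeasure_density) (auto simp: sets_mu)
qed

text \<open>The response law holds almost surely for each fixed Borel set, with an exceptional set
  depending on it. Therefore equality is shown on rectangles first, extended to measures by a
  \<pi>-system argument, and only then transported to general test functions.\<close>

lemma joint_density_response:
  assumes V: "joint_density t (\<lambda>\<omega>. L (Suc t) \<omega> = i) V"
    and Vm: "(\<lambda>(h, y). V h y) \<in> borel_measurable (borel \<Otimes>\<^sub>M obs_space t)"
    and V0: "\<And>h y. 0 \<le> V h y"
    and V_upd: "\<And>h y z. V h (y(Suc t := z)) = V h y"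
  shows "joint_density (Suc t) (\<lambda>\<omega>. L (Suc t) \<omega> = i)
    (\<lambda>h y. V h y * response_density i (\<xi> (Suc t) y) h (y (Suc t)))"
proof -
  let ?q = "\<lambda>hy z. response_density i (\<xi> (Suc t) (snd hy)) (fst hy) z"
  let ?V = "\<lambda>hy. V (fst hy) (snd hy)"
  let ?R = "prior \<Otimes>\<^sub>M ref t"
  let ?Z = "\<lambda>\<omega>. ((\<eta> \<omega>, obs t \<omega>), Y (Suc t) \<omega>)"
  let ?S = "(borel \<Otimes>\<^sub>M obs_space t) \<Otimes>\<^sub>M (borel :: 'y measure)"
  let ?I = "\<lambda>\<omega>. indicator {\<omega>. L (Suc t) \<omega> = i} \<omega> :: ennreal"
  have one: "1 \<le> Suc t" by simp
  note G = response_algebra[OF one, unfolded diff_Suc_1]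
  have \<xi>K: "\<xi> (Suc t) y \<in> {1..K}" for y by (rule policy_range) simp
  have Y[measurable]: "Y (Suc t) \<in> M \<rightarrow>\<^sub>M borel" by (rule Y_measurable) simp
  have Z[measurable]: "?Z \<in> M \<rightarrow>\<^sub>M ?S" by measurable
  have I: "?I \<in> borel_measurable M" by (rule borel_measurable_indicator_L)
  have Vm': "?V \<in> borel_measurable (borel \<Otimes>\<^sub>M obs_space t)" using Vm by (simp add: case_prod_beta)
  have qm: "(\<lambda>a. ?q (fst a) (snd a)) \<in> borel_measurable ?S"
    by (rule measurable_response_density[where t=t, OF response_density(1)]) measurable
  have sets_R: "sets (?R \<Otimes>\<^sub>M \<mu>) = sets ?S"
    by (intro sets_pair_measure_cong sets_prior sets_ref sets_mu)
  have Pred: "Measurable.pred (response_algebra (Suc t)) (\<lambda>\<omega>. L (Suc t) \<omega> = i)"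
    using G(3) unfolding diff_Suc_1 by (intro pred_eq_const1) auto
  interpret mu: sigma_finite_measure \<mu> by unfold_locales
  interpret R: sigma_finite_measure "ref t" by (rule sigma_finite_ref)
  interpret R': sigma_finite_measure "ref (Suc t)" by (rule sigma_finite_ref)
  \<comment> \<open>\<open>\<nu>1\<close> is the law of the old data and the new response,
    restricted to the current state \<open>i\<close>; \<open>\<nu>2\<close> is the measure with the
    claimed product density, before the response is appended to the vector.\<close>
  define \<nu>1 where "\<nu>1 = distr (density M ?I) ?S ?Z"
  define \<nu>2 where "\<nu>2 = density (?R \<Otimes>\<^sub>M \<mu>) (\<lambda>a. ennreal (?V (fst a)) * ennreal (?q (fst a) (snd a)))"
  have dens: "(\<lambda>a. ennreal (?V (fst a)) * ennreal (?q (fst a) (snd a))) \<in> borel_measurable (?R \<Otimes>\<^sub>M \<mu>)"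
    unfolding measurable_cong_sets[OF sets_R refl]
    using measurable_compose[OF measurable_fst Vm'] qm by measurable
  have rect: "emeasure \<nu>1 (A \<times> B) = emeasure \<nu>2 (A \<times> B)"
    if A: "A \<in> sets (borel \<Otimes>\<^sub>M obs_space t)" and B: "B \<in> sets borel" for A B
  proof -
    let ?m = "\<lambda>hy. \<integral>\<^sup>+z. ennreal (?q hy z) * indicator B z \<partial>\<mu>"
    have AB: "A \<times> B \<in> sets ?S" using A B by auto
    have mm: "?m \<in> borel_measurable (borel \<Otimes>\<^sub>M obs_space t)"
      by (rule mu.borel_measurable_nn_integral) (use qm B in \<open>simp add: case_prod_beta\<close>)
    have "emeasure \<nu>1 (A \<times> B) = (\<integral>\<^sup>+\<omega>. ?I \<omega> * indicator (?Z -` (A \<times> B) \<inter> space M) \<omega> \<partial>M)"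
      unfolding \<nu>1_def using AB I Z
      by (subst emeasure_distr) (simp_all add: emeasure_density measurable_sets[OF Z])
    also have "\<dots> = (\<integral>\<^sup>+\<omega>. (indicator A (\<eta> \<omega>, obs t \<omega>) * ?I \<omega>) * indicator {\<omega>. Y (Suc t) \<omega> \<in> B} \<omega> \<partial>M)"
      by (rule nn_integral_cong) (auto split: split_indicator)
    also have "\<dots> = (\<integral>\<^sup>+\<omega>. (indicator A (\<eta> \<omega>, obs t \<omega>) * ?I \<omega>) *
       ennreal (measure (density \<mu> (\<lambda>y. ennreal (if L (Suc t) \<omega> = 0 then f (X (Suc t) \<omega>) (\<eta> \<omega>) y
          else g (X (Suc t) \<omega>) (\<eta> \<omega>) y))) B) \<partial>M)"
    proof (rule nn_integral_cond_prob_given[where R="\<lambda>_. True"])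
      show "subalgebra M (response_algebra (Suc t))" by (rule response_algebra(1)[OF one])
      show "Measurable.pred M (\<lambda>\<omega>. Y (Suc t) \<omega> \<in> B)" using B by measurable
      \<comment> \<open>The conditioning algebra for the response contains the current state, so its
        indicator may be part of the test function.\<close>
      have "?I \<in> borel_measurable (response_algebra (Suc t))"
        using Pred by (intro borel_measurable_indicator') (simp add: Measurable.pred_def)
      then show "(\<lambda>\<omega>. indicator A (\<eta> \<omega>, obs t \<omega>) * ?I \<omega>) \<in> borel_measurable (response_algebra (Suc t))"
        using measurable_compose[OF G(2) borel_measurable_indicator[OF A]] unfolding diff_Suc_1
        by (intro borel_measurable_times_ennreal)
      show "AE \<omega> in M. True \<longrightarrow> cond_prob_given M (response_algebra (Suc t)) (\<lambda>\<omega>. Y (Suc t) \<omega> \<in> B) \<omega> =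
         measure (density \<mu> (\<lambda>y. ennreal (if L (Suc t) \<omega> = 0 then f (X (Suc t) \<omega>) (\<eta> \<omega>) y
          else g (X (Suc t) \<omega>) (\<eta> \<omega>) y))) B"
        using response_law[OF one B] by (rule AE_mp) simp
    qed simp
    also have "\<dots> = (\<integral>\<^sup>+\<omega>. (\<lambda>hy. indicator A hy * ?m hy) (\<eta> \<omega>, obs t \<omega>) * ?I \<omega> \<partial>M)"
    proof (rule nn_integral_cong)
      fix \<omega> assume \<omega>: "\<omega> \<in> space M"
      \<comment> \<open>Where the state is \<open>i\<close>, the law in the model has density
        \<open>response_density i\<close>; elsewhere \<open>?I\<close> makes both sides
        vanish.\<close>
      have "(\<lambda>y. ennreal (if L (Suc t) \<omega> = 0 then f (X (Suc t) \<omega>) (\<eta> \<omega>) y else g (X (Suc t) \<omega>) (\<eta> \<omega>) y))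
          = (\<lambda>y. ennreal (response_density i (\<xi> (Suc t) (obs t \<omega>)) (\<eta> \<omega>) y))" if "L (Suc t) \<omega> = i"
        using that X_obs[OF one order_refl \<omega>] by (auto simp: response_density_def)
      then show "(indicator A (\<eta> \<omega>, obs t \<omega>) * ?I \<omega>) *
         ennreal (measure (density \<mu> (\<lambda>y. ennreal (if L (Suc t) \<omega> = 0 then f (X (Suc t) \<omega>) (\<eta> \<omega>) y
            else g (X (Suc t) \<omega>) (\<eta> \<omega>) y))) B) = (\<lambda>hy. indicator A hy * ?m hy) (\<eta> \<omega>, obs t \<omega>) * ?I \<omega>"
        by (cases "L (Suc t) \<omega> = i") (simp_all add: ennreal_measure_response[OF \<xi>K B])
    qed
    \<comment> \<open>The density before the response is applied with the kernel \<open>?m\<close>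
      as part of the test function.\<close>
    also have "\<dots> = (\<integral>\<^sup>+hy. (indicator A hy * ?m hy) * ennreal (?V hy) \<partial>?R)"
      using A mm by (intro joint_densityD[OF V] borel_measurable_times_ennreal) auto
    also have "\<dots> = (\<integral>\<^sup>+hy. \<integral>\<^sup>+z. ennreal (?V hy) * ennreal (?q hy z) * indicator (A \<times> B) (hy, z) \<partial>\<mu> \<partial>?R)"
    proof (rule nn_integral_cong)
      fix hy
      have "(\<lambda>z. ennreal (?q hy z) * indicator B z) \<in> borel_measurable \<mu>"
        using response_density_measurable2[OF \<xi>K] B by (auto simp: sets_mu)
      then have "(\<integral>\<^sup>+z. (indicator A hy * ennreal (?V hy)) * (ennreal (?q hy z) * indicator B z) \<partial>\<mu>)
          = (indicator A hy * ennreal (?V hy)) * ?m hy"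
        by (rule nn_integral_cmult)
      moreover have "(\<integral>\<^sup>+z. ennreal (?V hy) * ennreal (?q hy z) * indicator (A \<times> B) (hy, z) \<partial>\<mu>)
         = (\<integral>\<^sup>+z. (indicator A hy * ennreal (?V hy)) * (ennreal (?q hy z) * indicator B z) \<partial>\<mu>)"
        by (rule nn_integral_cong) (simp add: indicator_times mult_ac)
      ultimately show "(indicator A hy * ?m hy) * ennreal (?V hy)
         = (\<integral>\<^sup>+z. ennreal (?V hy) * ennreal (?q hy z) * indicator (A \<times> B) (hy, z) \<partial>\<mu>)"
        by (simp add: mult_ac)
    qed
    also have "\<dots> = (\<integral>\<^sup>+a. ennreal (?V (fst a)) * ennreal (?q (fst a) (snd a)) * indicator (A \<times> B) a \<partial>(?R \<Otimes>\<^sub>M \<mu>))"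
      by (subst mu.nn_integral_fst[symmetric]) (use dens AB sets_R in \<open>auto\<close>)
    also have "\<dots> = emeasure \<nu>2 (A \<times> B)"
      unfolding \<nu>2_def by (rule emeasure_density[symmetric, OF dens]) (simp add: sets_R AB)
    finally show ?thesis .
  qed
  have \<nu>_eq: "\<nu>1 = \<nu>2"
  proof (rule measure_eqI_generator_eq[OF Int_stable_pair_measure_generator])
    let ?E = "{A \<times> B |A B. A \<in> sets (borel \<Otimes>\<^sub>M obs_space t) \<and> B \<in> sets (borel :: 'y measure)}"
    let ?\<Omega> = "space (borel \<Otimes>\<^sub>M obs_space t) \<times> space (borel :: 'y measure)"
    show "?E \<subseteq> Pow ?\<Omega>" by (rule pair_measure_closed)
    show "emeasure \<nu>1 C = emeasure \<nu>2 C" if "C \<in> ?E" for C using that rect by blast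
    show "sets \<nu>1 = sigma_sets ?\<Omega> ?E" by (simp add: \<nu>1_def sets_pair_measure)
    show "sets \<nu>2 = sigma_sets ?\<Omega> ?E" using sets_R by (simp add: \<nu>2_def sets_pair_measure)
    \<comment> \<open>A constant sequence exhausts the space, because \<open>\<nu>1\<close> has
      total mass at most 1.\<close>
    show "range (\<lambda>_::nat. ?\<Omega>) \<subseteq> ?E" by blast
    show "(\<Union>_::nat. ?\<Omega>) = ?\<Omega>" by simp
    have "emeasure \<nu>1 ?\<Omega> = emeasure (density M ?I) (?Z -` ?\<Omega> \<inter> space M)"
      unfolding \<nu>1_def by (subst emeasure_distr) (use Z in \<open>auto simp: space_pair_measure[symmetric]\<close>)
    also have "\<dots> \<le> emeasure (density M ?I) (space M)"
      by (rule emeasure_mono) auto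
    also have "\<dots> \<le> (\<integral>\<^sup>+\<omega>. 1 \<partial>M)"
      by (subst emeasure_density[OF I sets.top], rule nn_integral_mono) (auto split: split_indicator)
    also have "\<dots> < \<infinity>" by (simp add: emeasure_space_1)
    finally show "emeasure \<nu>1 ?\<Omega> \<noteq> \<infinity>" by simp
  qed
  show ?thesis
    unfolding joint_density_def
  proof
    fix F :: "'h \<times> (nat \<Rightarrow> 'y) \<Rightarrow> ennreal"
    assume F: "F \<in> borel_measurable (borel \<Otimes>\<^sub>M obs_space (Suc t))"
    \<comment> \<open>\<open>T\<close> appends the new response, identifying \<open>ref t\<close>
      times \<mu> with \<open>ref (Suc t)\<close>.\<close>
    define T :: "('h \<times> (nat \<Rightarrow> 'y)) \<times> 'y \<Rightarrow> 'h \<times> (nat \<Rightarrow> 'y)" where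
      "T = (\<lambda>a. (fst (fst a), (snd (fst a))(Suc t := snd a)))"
    have ins: "{1..Suc t} = insert (Suc t) {1..t}" by auto
    have T: "T \<in> ?S \<rightarrow>\<^sub>M borel \<Otimes>\<^sub>M obs_space (Suc t)"
      unfolding T_def ins by measurable
    have FT: "(\<lambda>a. F (T a)) \<in> borel_measurable ?S" by (rule measurable_compose[OF T F])
    let ?W = "\<lambda>hy. V (fst hy) (snd hy) * response_density i (\<xi> (Suc t) (snd hy)) (fst hy) (snd hy (Suc t))"
    have "(\<lambda>a. response_density i (\<xi> (Suc t) (snd a)) (fst a) (snd a (Suc t))) \<in> borel_measurable ((borel :: 'h measure) \<Otimes>\<^sub>M obs_space (Suc t))"
      by (rule measurable_response_density[where t="Suc t", OF response_density(1)]) auto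
    \<comment> \<open>\<open>Vm'\<close> concerns vectors of length \<open>t\<close>. Restricting
      such a longer vector and writing its last coordinate back returns the vector itself, so
      \<open>V_upd\<close> shows that \<open>V\<close> ignores the restriction.\<close>
    moreover have "?V \<in> borel_measurable (borel \<Otimes>\<^sub>M obs_space (Suc t))"
    proof -
      have "(\<lambda>a. ?V (fst a, restrict (snd a) {1..t})) \<in> borel_measurable (borel \<Otimes>\<^sub>M obs_space (Suc t))"
        by (intro measurable_compose[OF _ Vm'] measurable_Pair measurable_fst
            measurable_compose[OF measurable_snd measurable_restrict_subset]) auto
      also have "?this \<longleftrightarrow> ?thesis"
      proof (rule measurable_cong)
        fix a :: "'h \<times> (nat \<Rightarrow> 'y)" assume "a \<in> space (borel \<Otimes>\<^sub>M obs_space (Suc t))"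
        then have "snd a = (restrict (snd a) {1..t})(Suc t := snd a (Suc t))"
          by (auto simp: space_pair_measure space_PiM fun_eq_iff PiE_def extensional_def)
        then show "?V (fst a, restrict (snd a) {1..t}) = ?V a"
          by (metis V_upd fst_conv snd_conv)
      qed
      finally show ?thesis .
    qed
    ultimately have FW: "(\<lambda>hy. F hy * ennreal (?W hy)) \<in> borel_measurable (borel \<Otimes>\<^sub>M obs_space (Suc t))"
      using F by measurable
    have "(\<integral>\<^sup>+\<omega>. F (\<eta> \<omega>, obs (Suc t) \<omega>) * ?I \<omega> \<partial>M) = (\<integral>\<^sup>+\<omega>. ?I \<omega> * F (T (?Z \<omega>)) \<partial>M)"
      by (simp add: T_def obs_Suc mult.commute)
    also have "\<dots> = (\<integral>\<^sup>+\<omega>. F (T (?Z \<omega>)) \<partial>density M ?I)"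
      using I measurable_compose[OF Z FT] by (subst nn_integral_density) auto
    also have "\<dots> = (\<integral>\<^sup>+a. F (T a) \<partial>\<nu>1)"
      unfolding \<nu>1_def using FT Z by (subst nn_integral_distr) auto
    also have "\<dots> = (\<integral>\<^sup>+a. ennreal (?V (fst a)) * ennreal (?q (fst a) (snd a)) * F (T a) \<partial>(?R \<Otimes>\<^sub>M \<mu>))"
      unfolding \<nu>_eq \<nu>2_def using dens FT sets_R
      by (subst nn_integral_density) (auto simp: measurable_cong_sets[OF sets_R refl])
    also have "\<dots> = (\<integral>\<^sup>+a. F (T a) * ennreal (?W (T a)) \<partial>(?R \<Otimes>\<^sub>M \<mu>))"
      by (rule nn_integral_cong)
        (simp add: T_def V_upd policy_upd ennreal_mult V0 response_density(2)[OF \<xi>K] mult_ac)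
    also have "\<dots> = (\<integral>\<^sup>+hy. \<integral>\<^sup>+z. F (T (hy, z)) * ennreal (?W (T (hy, z))) \<partial>\<mu> \<partial>?R)"
      using measurable_compose[OF T FW]
      by (subst mu.nn_integral_fst[symmetric]) (auto simp: measurable_cong_sets[OF sets_R refl])
    also have "\<dots> = (\<integral>\<^sup>+h. \<integral>\<^sup>+y. \<integral>\<^sup>+z. F (T ((h, y), z)) * ennreal (?W (T ((h, y), z))) \<partial>\<mu> \<partial>ref t \<partial>prior)"
      using mu.borel_measurable_nn_integral[of "\<lambda>hy z. F (T (hy, z)) * ennreal (?W (T (hy, z)))" "?R"] 
        measurable_compose[OF T FW]
      by (subst R.nn_integral_fst[symmetric]) (auto simp: measurable_cong_sets[OF sets_R refl] case_prod_beta)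
    \<comment> \<open>For fixed \<open>h\<close>, the product integral over
      \<open>{1..Suc t}\<close> is the iterated integral that splits off the index
      \<open>Suc t\<close>.\<close>
    also have "\<dots> = (\<integral>\<^sup>+h. \<integral>\<^sup>+y. F (h, y) * ennreal (?W (h, y)) \<partial>ref (Suc t) \<partial>prior)"
    proof (rule nn_integral_cong)
      fix h
      have "(\<lambda>y. F (h, y) * ennreal (?W (h, y))) \<in> borel_measurable (ref (Suc t))"
        unfolding measurable_cong_sets[OF sets_ref refl]
        by (rule measurable_compose[OF measurable_Pair1' FW]) simp
      then have "(\<integral>\<^sup>+y. F (h, y) * ennreal (?W (h, y)) \<partial>ref (Suc t))
          = (\<integral>\<^sup>+y. \<integral>\<^sup>+z. F (h, y(Suc t := z)) * ennreal (?W (h, y(Suc t := z))) \<partial>\<mu> \<partial>ref t)"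
        unfolding ins by (subst mu_product.product_nn_integral_insert) auto
      then show "(\<integral>\<^sup>+y. \<integral>\<^sup>+z. F (T ((h, y), z)) * ennreal (?W (T ((h, y), z))) \<partial>\<mu> \<partial>ref t)
          = (\<integral>\<^sup>+y. F (h, y) * ennreal (?W (h, y)) \<partial>ref (Suc t))"
        by (simp add: T_def)
    qed
    also have "\<dots> = (\<integral>\<^sup>+z. F z * ennreal (?W z) \<partial>(prior \<Otimes>\<^sub>M ref (Suc t)))"
      by (rule R'.nn_integral_fst)
        (use FW in \<open>simp add: measurable_cong_sets[OF sets_pair_measure_cong[OF sets_prior sets_ref] refl]\<close>)
    finally show "(\<integral>\<^sup>+\<omega>. F (\<eta> \<omega>, obs (Suc t) \<omega>) * ?I \<omega> \<partial>M)
       = (\<integral>\<^sup>+z. F z * ennreal (?W z) \<partial>(prior \<Otimes>\<^sub>M ref (Suc t)))" .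
  qed
qed

text \<open>Both densities are carried through one induction because the recursion of
  \<open>N\<close> involves \<open>D\<close>.\<close>

lemma joint_density_L:
  "joint_density t (\<lambda>\<omega>. L t \<omega> = 0) (D t)" "joint_density t (\<lambda>\<omega>. L t \<omega> = 1) (N t)"
proof (induction t)
  case 0
  let ?G = "sigma (space M) (events_of M borel \<eta>)"
  have "joint_density 0 (\<lambda>\<omega>. L 0 \<omega> = 1) (\<lambda>h y. p0 h)"
    by (rule joint_density_initial[OF pred_L p0_measurable initial_law])
  then show "joint_density 0 (\<lambda>\<omega>. L 0 \<omega> = 1) (N 0)" by (simp add: joint_density_def)
  have "AE \<omega> in M. cond_prob_given M ?G (\<lambda>\<omega>. \<not> L 0 \<omega> = 1) \<omega> = 1 - cond_prob_given M ?G (\<lambda>\<omega>. L 0 \<omega> = 1) \<omega>"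
    by (rule cond_prob_given_not[OF initial_algebra(1) pred_L])
  then have "AE \<omega> in M. cond_prob_given M ?G (\<lambda>\<omega>. L 0 \<omega> = 0) \<omega> = 1 - p0 (\<eta> \<omega>)"
    using initial_law unfolding latent_eq_1_iff not_not by eventually_elim simp
  then have "joint_density 0 (\<lambda>\<omega>. L 0 \<omega> = 0) (\<lambda>h y. 1 - p0 h)"
    using p0_measurable by (intro joint_density_initial[OF pred_L]) auto
  then show "joint_density 0 (\<lambda>\<omega>. L 0 \<omega> = 0) (D 0)" by (simp add: joint_density_def D_0)
next
  case (Suc t)
  note trans = joint_density_transition[OF Suc]
  have tr: "(\<lambda>a. policy_trans (Suc t) (fst a) (snd a)) \<in> borel_measurable (borel \<Otimes>\<^sub>M obs_space t)"
    using measurable_trans[of "Suc t" t] by (simp add: case_prod_beta)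
  have m: "(\<lambda>a. D t (fst a) (snd a)) \<in> borel_measurable (borel \<Otimes>\<^sub>M obs_space t)"
    "(\<lambda>a. N t (fst a) (snd a)) \<in> borel_measurable (borel \<Otimes>\<^sub>M obs_space t)"
    using measurable_D[of t t] measurable_N[of t t] by (simp_all add: case_prod_beta)
  have r: "0 \<le> policy_trans (Suc t) h y" "policy_trans (Suc t) h y \<le> 1" for h y
    using trans_range[of "Suc t" h y] by auto
  have "joint_density (Suc t) (\<lambda>\<omega>. L (Suc t) \<omega> = 0)
      (\<lambda>h y. (1 - policy_trans (Suc t) h y) * D t h y * response_density 0 (\<xi> (Suc t) y) h (y (Suc t)))"
    by (rule joint_density_response[OF trans(1)])
      (use tr m r in \<open>auto simp: case_prod_beta D_nonneg trans_upd D_upd\<close>)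
  then show "joint_density (Suc t) (\<lambda>\<omega>. L (Suc t) \<omega> = 0) (D (Suc t))"
    by (simp add: joint_density_def D_Suc response_density_def)
  have "joint_density (Suc t) (\<lambda>\<omega>. L (Suc t) \<omega> = 1)
      (\<lambda>h y. (N t h y + policy_trans (Suc t) h y * D t h y) * response_density 1 (\<xi> (Suc t) y) h (y (Suc t)))"
    by (rule joint_density_response[OF trans(2)])
      (use tr m r in \<open>auto simp: case_prod_beta D_nonneg N_nonneg trans_upd D_upd N_upd\<close>)
  then show "joint_density (Suc t) (\<lambda>\<omega>. L (Suc t) \<omega> = 1) (N (Suc t))"
    by (simp add: joint_density_def response_density_def)
qed

section \<open>Posterior odds\<close>

text \<open>Integrating the parameter out of a joint density leaves a density of
  \<open>obs t\<close> with respect to \<open>ref t\<close>. It takes values in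
  \<open>ennreal\<close> because the integral may be infinite at individual
  \<open>y\<close>.\<close>

definition marginal :: "('h \<Rightarrow> (nat \<Rightarrow> 'y) \<Rightarrow> real) \<Rightarrow> (nat \<Rightarrow> 'y) \<Rightarrow> ennreal" where
  "marginal w y = (\<integral>\<^sup>+h. ennreal (w h y) \<partial>prior)"

lemma measurable_marginal:
  assumes "(\<lambda>(h, y). w h y) \<in> borel_measurable (borel \<Otimes>\<^sub>M obs_space t)"
  shows "marginal w \<in> borel_measurable (obs_space t)"
  unfolding marginal_def
proof (rule prior.borel_measurable_nn_integral)
  have "(\<lambda>a. (snd a, fst a)) \<in> obs_space t \<Otimes>\<^sub>M prior \<rightarrow>\<^sub>M borel \<Otimes>\<^sub>M obs_space t"
    by measurable
  from measurable_compose[OF this assms]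
  show "(\<lambda>(y, h). ennreal (w h y)) \<in> borel_measurable (obs_space t \<Otimes>\<^sub>M prior)"
    by (simp add: case_prod_beta)
qed

lemma nn_integral_obs:
  assumes P: "joint_density t P w" and w: "(\<lambda>(h, y). w h y) \<in> borel_measurable (borel \<Otimes>\<^sub>M obs_space t)"
    and F: "F \<in> borel_measurable (obs_space t)"
  shows "(\<integral>\<^sup>+\<omega>. F (obs t \<omega>) * indicator {\<omega>. P \<omega>} \<omega> \<partial>M) = (\<integral>\<^sup>+y. F y * marginal w y \<partial>ref t)"
proof -
  interpret R: sigma_finite_measure "ref t" by (rule sigma_finite_ref)
  interpret pair_sigma_finite prior "ref t" ..
  have Fs: "(\<lambda>a. F (snd a)) \<in> borel_measurable ((borel :: 'h measure) \<Otimes>\<^sub>M obs_space t)"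
    by (rule measurable_compose[OF measurable_snd F])
  have "(\<integral>\<^sup>+\<omega>. F (obs t \<omega>) * indicator {\<omega>. P \<omega>} \<omega> \<partial>M)
      = (\<integral>\<^sup>+z. F (snd z) * ennreal (w (fst z) (snd z)) \<partial>(prior \<Otimes>\<^sub>M ref t))"
    using joint_densityD[OF P Fs] by simp
  also have "\<dots> = (\<integral>\<^sup>+y. \<integral>\<^sup>+h. F y * ennreal (w h y) \<partial>prior \<partial>ref t)"
    by (subst nn_integral_snd[symmetric]) (use w Fs in \<open>simp_all add: case_prod_beta
      measurable_cong_sets[OF sets_pair_measure_cong[OF sets_prior sets_ref] refl]\<close>)
  also have "\<dots> = (\<integral>\<^sup>+y. F y * marginal w y \<partial>ref t)"
  proof (rule nn_integral_cong)
    fix y assume "y \<in> space (ref t)"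
    then have "y \<in> space (obs_space t)" using sets_eq_imp_space_eq[OF sets_ref] by simp
    then have "(\<lambda>h. w h y) \<in> borel_measurable prior"
      using measurable_compose[OF measurable_Pair2' w, of y] by (simp add: measurable_cong_sets[OF sets_prior refl])
    then show "(\<integral>\<^sup>+h. F y * ennreal (w h y) \<partial>prior) = F y * marginal w y"
      unfolding marginal_def by (intro nn_integral_cmult) simp
  qed
  finally show ?thesis .
qed

abbreviation total_density :: "nat \<Rightarrow> (nat \<Rightarrow> 'y) \<Rightarrow> ennreal" where
  "total_density t y \<equiv> marginal (N t) y + marginal (D t) y"

lemma nn_integral_obs_total:
  assumes F: "F \<in> borel_measurable (obs_space t)"
  shows "(\<integral>\<^sup>+\<omega>. F (obs t \<omega>) \<partial>M) = (\<integral>\<^sup>+y. F y * total_density t y \<partial>ref t)"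
proof -
  note m = measurable_compose[OF measurable_obs F] borel_measurable_indicator_L
  have mF: "marginal (N t) \<in> borel_measurable (ref t)" "marginal (D t) \<in> borel_measurable (ref t)" "F \<in> borel_measurable (ref t)"
    using F measurable_marginal[OF measurable_N[OF order_refl]] measurable_marginal[OF measurable_D[OF order_refl]]
    by (simp_all add: measurable_cong_sets[OF sets_ref refl])
  have "(\<integral>\<^sup>+\<omega>. F (obs t \<omega>) \<partial>M)
      = (\<integral>\<^sup>+\<omega>. F (obs t \<omega>) * indicator {\<omega>. L t \<omega> = 1} \<omega> + F (obs t \<omega>) * indicator {\<omega>. L t \<omega> = 0} \<omega> \<partial>M)"
    unfolding latent_eq_1_iff by (rule nn_integral_cong) (auto split: split_indicator)
  also have "\<dots> = (\<integral>\<^sup>+\<omega>. F (obs t \<omega>) * indicator {\<omega>. L t \<omega> = 1} \<omega> \<partial>M)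
      + (\<integral>\<^sup>+\<omega>. F (obs t \<omega>) * indicator {\<omega>. L t \<omega> = 0} \<omega> \<partial>M)"
    by (intro nn_integral_add borel_measurable_times_ennreal m)
  also have "\<dots> = (\<integral>\<^sup>+y. F y * marginal (N t) y \<partial>ref t) + (\<integral>\<^sup>+y. F y * marginal (D t) y \<partial>ref t)"
    by (simp only: nn_integral_obs[OF joint_density_L(1) measurable_D[OF order_refl] F]
        nn_integral_obs[OF joint_density_L(2) measurable_N[OF order_refl] F])
  also have "\<dots> = (\<integral>\<^sup>+y. F y * total_density t y \<partial>ref t)"
    using mF by (subst nn_integral_add[symmetric]) (auto simp: distrib_left)
  finally show ?thesis .
qed

lemma measurable_total: "total_density t \<in> borel_measurable (obs_space t)"
  by (intro borel_measurable_add measurable_marginal measurable_N measurable_D order_refl)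

lemma AE_total_finite: "AE y in ref t. total_density t y < \<infinity>"
proof -
  have "(\<integral>\<^sup>+y. 1 * total_density t y \<partial>ref t) = 1"
    using nn_integral_obs_total[of "\<lambda>_. 1" t] by (simp add: emeasure_space_1)
  then show ?thesis
    using nn_integral_PInf_AE[of "total_density t" "ref t"] measurable_total[of t]
    by (auto simp: measurable_cong_sets[OF sets_ref refl] less_top)
qed

text \<open>The law of \<open>obs t\<close> has density \<open>total_density t\<close>: it gives no
  mass to the zero set of this density, and the infinite set is null already for
  \<open>ref t\<close>. Positivity thus concerns the observed vector, not
  \<open>ref t\<close>-almost every \<open>y\<close>.\<close>

lemma AE_total_obs: "AE \<omega> in M. 0 < total_density t (obs t \<omega>) \<and> total_density t (obs t \<omega>) < \<infinity>"
proof -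
  note [measurable] = measurable_total[of t]
  let ?F = "indicator {y \<in> space (obs_space t). \<not> (0 < total_density t y \<and> total_density t y < \<infinity>)} :: _ \<Rightarrow> ennreal"
  have F: "?F \<in> borel_measurable (obs_space t)" by measurable
  have "(\<integral>\<^sup>+\<omega>. ?F (obs t \<omega>) \<partial>M) = (\<integral>\<^sup>+y. ?F y * total_density t y \<partial>ref t)"
    by (rule nn_integral_obs_total[OF F])
  also have "\<dots> = (\<integral>\<^sup>+y. 0 \<partial>ref t)"
    using AE_total_finite[of t]
    by (intro nn_integral_cong_AE, eventually_elim) (auto split: split_indicator)
  finally have "(\<integral>\<^sup>+\<omega>. ?F (obs t \<omega>) \<partial>M) = 0" by simp
  then have "AE \<omega> in M. ?F (obs t \<omega>) = 0"
    using measurable_compose[OF measurable_obs F] by (subst (asm) nn_integral_0_iff_AE) auto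
  then show ?thesis using AE_space
    by eventually_elim (use measurable_space[OF measurable_obs] in
      \<open>auto simp: zero_less_iff_neq_zero split: split_indicator_asm\<close>)
qed

text \<open>Bayes' formula, verified through the characterisation of conditional expectation: each
  filtration event is a preimage under \<open>obs t\<close>, so the defining identity becomes one
  between integrals over \<open>ref t\<close>.\<close>

lemma posterior:
  assumes P: "joint_density t (\<lambda>\<omega>. L t \<omega> = i) w"
    and w: "(\<lambda>(h, y). w h y) \<in> borel_measurable (borel \<Otimes>\<^sub>M obs_space t)"
    and le: "\<And>y. marginal w y \<le> total_density t y"
  shows "AE \<omega> in M. ennreal (cond_prob_given M (obs_filtration M X Y (enat t)) (\<lambda>\<omega>. L t \<omega> = i) \<omega>)
    = marginal w (obs t \<omega>) / total_density t (obs t \<omega>)"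
proof -
  let ?F = "obs_filtration M X Y (enat t)"
  let ?L = "indicator {\<omega> \<in> space M. L t \<omega> = i}"
  let ?r = "\<lambda>y. marginal w y / total_density t y"
  interpret F: finite_measure_subalgebra M ?F by (rule finite_measure_subalgebra[OF subalgebra_filtration])
  have r: "?r \<in> borel_measurable (obs_space t)"
    by (intro borel_measurable_divide_ennreal measurable_marginal[OF w] measurable_total)
  have "AE \<omega> in M. ?r (obs t \<omega>) = nn_cond_exp M ?F ?L \<omega>"
  proof (rule F.nn_cond_exp_charact)
    show "?L \<in> borel_measurable M"
      using pred_L by (intro borel_measurable_indicator) (simp add: Measurable.pred_def)
    show "(\<lambda>\<omega>. ?r (obs t \<omega>)) \<in> borel_measurable ?F"
      by (rule measurable_compose[OF obs_measurable_filtration r])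
    fix A assume "A \<in> sets ?F"
    then obtain C where C: "C \<in> sets (obs_space t)" and A: "A = obs t -` C \<inter> space M"
      by (rule sets_filtration_obs)
    have "(\<integral>\<^sup>+\<omega>\<in>A. ?L \<omega> \<partial>M) = (\<integral>\<^sup>+\<omega>. indicator C (obs t \<omega>) * indicator {\<omega>. L t \<omega> = i} \<omega> \<partial>M)"
      by (rule nn_integral_cong) (auto simp: A split: split_indicator)
    also have "\<dots> = (\<integral>\<^sup>+y. indicator C y * marginal w y \<partial>ref t)"
      using C by (intro nn_integral_obs[OF P w]) simp
    also have "\<dots> = (\<integral>\<^sup>+y. (indicator C y * ?r y) * total_density t y \<partial>ref t)"
    proof (rule nn_integral_cong_AE)
      show "AE y in ref t. indicator C y * marginal w y = (indicator C y * ?r y) * total_density t y"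
        using AE_total_finite[of t]
      proof eventually_elim
        case (elim y)
        \<comment> \<open>A zero total forces a zero numerator by \<open>le\<close>; otherwise the
          total is positive and finite, and the division can be undone.\<close>
        have "marginal w y = ?r y * total_density t y"
        proof (cases "total_density t y = 0")
          case True
          then show ?thesis using le[of y] by simp
        next
          case False
          then show ?thesis using elim by (simp add: ennreal_divide_times ennreal_mult_divide_eq less_top)
        qed
        then show ?case by (simp add: mult.assoc)
      qed
    qed
    also have "\<dots> = (\<integral>\<^sup>+\<omega>. indicator C (obs t \<omega>) * ?r (obs t \<omega>) \<partial>M)"
      using C r by (intro nn_integral_obs_total[symmetric] borel_measurable_times_ennreal) simp_all
    also have "\<dots> = (\<integral>\<^sup>+\<omega>\<in>A. ?r (obs t \<omega>) \<partial>M)"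
      by (rule nn_integral_cong) (auto simp: A split: split_indicator)
    finally show "(\<integral>\<^sup>+\<omega>\<in>A. ?L \<omega> \<partial>M) = (\<integral>\<^sup>+\<omega>\<in>A. ?r (obs t \<omega>) \<partial>M)" .
  qed
  with ennreal_cond_prob_given[OF subalgebra_filtration pred_L] show ?thesis
    by eventually_elim simp
qed

lemma posterior_odds_marginal:
  "AE \<omega> in M. posterior_odds M X Y \<Theta> t \<omega> = marginal (N t) (obs t \<omega>) / marginal (D t) (obs t \<omega>)"
proof -
  have "AE \<omega> in M. ennreal (cond_prob_given M (obs_filtration M X Y (enat t)) (\<lambda>\<omega>. L t \<omega> = 1) \<omega>)
    = marginal (N t) (obs t \<omega>) / total_density t (obs t \<omega>)"
    by (rule posterior[OF joint_density_L(2) measurable_N]) auto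
  moreover have "AE \<omega> in M. ennreal (cond_prob_given M (obs_filtration M X Y (enat t)) (\<lambda>\<omega>. L t \<omega> = 0) \<omega>)
    = marginal (D t) (obs t \<omega>) / total_density t (obs t \<omega>)"
    by (rule posterior[OF joint_density_L(1) measurable_D]) auto
  ultimately show ?thesis using AE_total_obs[of t]
    unfolding posterior_odds_def by eventually_elim (simp add: ennreal_odds_eq)
qed

section \<open>Vanishing densities and the product of odds and likelihood\<close>

text \<open>The predicate may be nonmeasurable, so the response law is applied to a measurable
  \<mu>-null set \<open>B\<close> covering its failures; both possible densities give
  \<open>B\<close> mass 0.\<close>

lemma AE_response:
  assumes s: "1 \<le> s" and Q: "AE z in \<mu>. Q z"
  shows "AE \<omega> in M. Q (Y s \<omega>)"
proof -
  from Q obtain B where B: "{z \<in> space \<mu>. \<not> Q z} \<subseteq> B" "emeasure \<mu> B = 0" "B \<in> sets \<mu>"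
    by (rule AE_E)
  then have Bs: "B \<in> sets borel" by (simp add: sets_mu)
  let ?d = "\<lambda>\<omega>. measure (density \<mu> (\<lambda>y. ennreal
    (if L s \<omega> = 0 then f (X s \<omega>) (\<eta> \<omega>) y else g (X s \<omega>) (\<eta> \<omega>) y))) B"
  have d: "?d \<omega> = 0" if "\<omega> \<in> space M" for \<omega>
  proof -
    have "(\<lambda>y. if L s \<omega> = 0 then f (X s \<omega>) (\<eta> \<omega>) y else g (X s \<omega>) (\<eta> \<omega>) y)
        = response_density (L s \<omega>) (X s \<omega>) (\<eta> \<omega>)"
      by (auto simp: response_density_def)
    moreover have "emeasure (density \<mu> (\<lambda>y. ennreal (response_density (L s \<omega>) (X s \<omega>) (\<eta> \<omega>) y))) B = 0"
      using B response_density_measurable2[OF X_range[OF s that]]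
      by (subst emeasure_density) (auto intro!: nn_integral_null_set)
    ultimately show ?thesis by (simp add: measure_def fun_eq_iff)
  qed
  have "(\<integral>\<^sup>+\<omega>. 1 * indicator {\<omega>. Y s \<omega> \<in> B} \<omega> \<partial>M) = (\<integral>\<^sup>+\<omega>. 1 * ennreal (?d \<omega>) \<partial>M)"
    by (rule nn_integral_cond_prob_given[where R="\<lambda>_. True", OF response_algebra(1)[OF s]])
      (use response_law[OF s Bs] measurable_compose[OF Y_measurable[OF s] pred_sets2[OF Bs measurable_ident]] in auto)
  also have "\<dots> = (\<integral>\<^sup>+\<omega>. 0 \<partial>M)" by (rule nn_integral_cong) (simp add: d)
  finally have "(\<integral>\<^sup>+\<omega>. indicator {\<omega>. Y s \<omega> \<in> B} \<omega> \<partial>M) = 0" by simp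
  moreover have "(\<lambda>\<omega>. indicator {\<omega>. Y s \<omega> \<in> B} \<omega> :: ennreal) \<in> borel_measurable M"
    using measurable_compose[OF Y_measurable[OF s] borel_measurable_indicator[OF Bs]]
    by (simp add: indicator_def)
  ultimately have "AE \<omega> in M. indicator {\<omega>. Y s \<omega> \<in> B} \<omega> = (0 :: ennreal)"
    by (subst (asm) nn_integral_0_iff_AE) auto
  then show ?thesis
    by eventually_elim (use B(1) space_mu in \<open>auto split: split_indicator_asm\<close>)
qed

lemma AE_lik_ratio_well_defined:
  assumes wd: "lik_ratio_well_defined K prior \<mu> f g" and s: "1 \<le> s"
  shows "AE \<omega> in M. AE h in prior. f (X s \<omega>) h (Y s \<omega>) = 0 \<longrightarrow> g (X s \<omega>) h (Y s \<omega>) = 0"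
proof -
  interpret pair_sigma_finite prior \<mu> ..
  have "AE z in \<mu>. AE h in prior. f x h z = 0 \<longrightarrow> g x h z = 0" if x: "x \<in> {1..K}" for x
  proof -
    have fm: "(\<lambda>a. f x (fst a) (snd a)) \<in> borel_measurable (borel \<Otimes>\<^sub>M borel)"
      and gm: "(\<lambda>a. g x (fst a) (snd a)) \<in> borel_measurable (borel \<Otimes>\<^sub>M borel)"
      using f_measurable[OF x] g_measurable[OF x] by (simp_all add: case_prod_beta)
    have "{a \<in> space (prior \<Otimes>\<^sub>M \<mu>). f x (fst a) (snd a) = 0 \<longrightarrow> g x (fst a) (snd a) = 0} \<in> sets (prior \<Otimes>\<^sub>M \<mu>)"
      using fm gm by measurable
    moreover have "AE h in prior. AE z in \<mu>. f x h z = 0 \<longrightarrow> g x h z = 0"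
    proof -
      have "AE h in prior. absolutely_continuous (density \<mu> (\<lambda>y. ennreal (f x h y))) (density \<mu> (\<lambda>y. ennreal (g x h y)))"
        using wd x by (auto simp: lik_ratio_well_defined_def)
      then show ?thesis
      proof eventually_elim
        case (elim h)
        have m: "f x h \<in> borel_measurable \<mu>" "g x h \<in> borel_measurable \<mu>"
          using response_density_measurable2[OF x, of 0 h] response_density_measurable2[OF x, of 1 h]
          by (simp_all add: response_density_def)
        \<comment> \<open>The zero set of \<open>f x h\<close> is null under the density
          \<open>f\<close>, hence under the density \<open>g\<close>, so \<open>g x h\<close>
          vanishes \<mu>-almost everywhere on it.\<close>
        let ?B = "{z \<in> space \<mu>. f x h z = 0}"
        have B: "?B \<in> sets \<mu>" using m by measurable
        have "emeasure (density \<mu> (\<lambda>y. ennreal (f x h y))) ?B = (\<integral>\<^sup>+z. 0 \<partial>\<mu>)"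
          using m B by (subst emeasure_density, simp, simp) (rule nn_integral_cong, simp split: split_indicator)
        then have "?B \<in> null_sets (density \<mu> (\<lambda>y. ennreal (f x h y)))"
          using B by (simp add: null_sets_def)
        then have "?B \<in> null_sets (density \<mu> (\<lambda>y. ennreal (g x h y)))"
          using elim by (auto simp: absolutely_continuous_def)
        then have "AE z in \<mu>. z \<in> ?B \<longrightarrow> ennreal (g x h z) = 0"
          using m by (subst (asm) null_sets_density_iff) auto
        then show ?case using AE_space
          by eventually_elim (use g_nonneg[OF x] in \<open>auto intro: antisym\<close>)
      qed
    qed
    \<comment> \<open>Fubini for null sets reverses the quantifiers: the exceptional set now lies in
      the response space, where \<open>Y s \<omega>\<close> can be inserted.\<close>
    ultimately show ?thesis by (subst (asm) AE_commute) auto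
  qed
  \<comment> \<open>There are finitely many treatments, so one \<mu>-null set serves them all and
    the random treatment may be inserted afterwards.\<close>
  then have "AE z in \<mu>. \<forall>x\<in>{1..K}. AE h in prior. f x h z = 0 \<longrightarrow> g x h z = 0"
    by (intro AE_finite_allI) auto
  from AE_response[OF s this] show ?thesis
    using AE_space by eventually_elim (use X_range[OF s] in blast)
qed

text \<open>Each factor of \<open>D_par\<close> cancels the denominator introduced by the recursion
  of \<open>Gamma_par\<close>: the factor with the transition probability is never 0, and where
  \<open>f\<close> is 0 the assumption on \<open>g\<close> makes both sides 0.\<close>

lemma Gamma_D_eq_N:
  assumes "\<omega> \<in> space M"
    and "\<And>s. 1 \<le> s \<Longrightarrow> s \<le> t \<Longrightarrow> f (X s \<omega>) h (Y s \<omega>) = 0 \<Longrightarrow> g (X s \<omega>) h (Y s \<omega>) = 0"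
  shows "Gamma_par p0 p f g X Y t h \<omega> * D_par p0 p f X Y t h \<omega> = N t h (obs t \<omega>)"
  using assms(2)
proof (induction t)
  case 0
  then show ?case using p0_range[of h] by (auto simp: D_par_def)
next
  case (Suc t)
  let ?\<Gamma> = "Gamma_par p0 p f g X Y t h \<omega>" and ?D = "D_par p0 p f X Y t h \<omega>"
  let ?\<pi> = "trans_prob p X (Suc t) h \<omega>" and ?f = "f (X (Suc t) \<omega>) h (Y (Suc t) \<omega>)"
    and ?g = "g (X (Suc t) \<omega>) h (Y (Suc t) \<omega>)"
  have \<pi>: "?\<pi> = policy_trans (Suc t) h (obs t \<omega>)" by (rule trans_prob_obs[OF order_refl assms(1)])
  then have \<pi>1: "1 - ?\<pi> \<noteq> 0" using trans_range[of "Suc t" h "obs t \<omega>"] by auto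
  have X: "\<xi> (Suc t) (obs t \<omega>) = X (Suc t) \<omega>" using X_obs[of "Suc t" t \<omega>] assms(1) by simp
  have "N (Suc t) h (obs (Suc t) \<omega>) = (N t h (obs t \<omega>) + ?\<pi> * ?D) * ?g"
    by (simp add: obs_Suc N_upd D_upd trans_upd policy_upd \<pi> D_obs[OF assms(1)] X)
  also have "N t h (obs t \<omega>) = ?\<Gamma> * ?D" using Suc by simp
  finally have N: "N (Suc t) h (obs (Suc t) \<omega>) = (?\<Gamma> + ?\<pi>) * ?D * ?g" by (simp add: algebra_simps)
  have D: "D_par p0 p f X Y (Suc t) h \<omega> = ?D * (1 - ?\<pi>) * ?f" by (simp add: D_par_def)
  show ?case
  proof (cases "?f = 0")
    case True
    then show ?thesis using Suc.prems[of "Suc t"] unfolding N D by simp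
  next
    case False
    then show ?thesis using \<pi>1 unfolding N D by (simp add: lik_ratio_def)
  qed
qed

lemma posterior_odds_formula:
  assumes wd: "lik_ratio_well_defined K prior \<mu> f g"
  shows "AE \<omega> in M. posterior_odds M X Y \<Theta> t \<omega> =
    (\<integral>\<^sup>+h. ennreal (Gamma_par p0 p f g X Y t h \<omega> * D_par p0 p f X Y t h \<omega>) \<partial>prior) /
    (\<integral>\<^sup>+h. ennreal (D_par p0 p f X Y t h \<omega>) \<partial>prior)"
proof -
  have "AE \<omega> in M. \<forall>s\<in>{1..t}. AE h in prior. f (X s \<omega>) h (Y s \<omega>) = 0 \<longrightarrow> g (X s \<omega>) h (Y s \<omega>) = 0"
    using AE_lik_ratio_well_defined[OF wd] by (intro AE_finite_allI) auto
  with posterior_odds_marginal[of t] AE_space show ?thesis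
  proof eventually_elim
    case (elim \<omega>)
    \<comment> \<open>For fixed \<omega>, the finitely many prior-null sets of parameters, one for
      each time up to \<open>t\<close>, are merged into one.\<close>
    then have "AE h in prior. \<forall>s\<in>{1..t}. f (X s \<omega>) h (Y s \<omega>) = 0 \<longrightarrow> g (X s \<omega>) h (Y s \<omega>) = 0"
      by (intro AE_finite_allI) auto
    then have "AE h in prior. Gamma_par p0 p f g X Y t h \<omega> * D_par p0 p f X Y t h \<omega> = N t h (obs t \<omega>)"
      by eventually_elim (rule Gamma_D_eq_N, use elim in auto)
    then have "(\<integral>\<^sup>+h. ennreal (Gamma_par p0 p f g X Y t h \<omega> * D_par p0 p f X Y t h \<omega>) \<partial>prior) = marginal (N t) (obs t \<omega>)"
      unfolding marginal_def by (intro nn_integral_cong_AE, eventually_elim) simp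
    with elim show ?case by (simp add: marginal_def D_obs)
  qed
qed

end

theorem lemma7p1:
  fixes M :: "'a measure"
    and prior :: "'h::polish_space measure"
    and \<mu> :: "'y::polish_space measure"
    and K :: nat
    and p0 :: "'h \<Rightarrow> real"
    and p :: "nat \<Rightarrow> 'h \<Rightarrow> (nat \<Rightarrow> nat) \<Rightarrow> real"
    and f g :: "nat \<Rightarrow> 'h \<Rightarrow> 'y \<Rightarrow> real"
    and \<eta> :: "'a \<Rightarrow> 'h"
    and \<Theta> :: "'a \<Rightarrow> enat"
    and X :: "nat \<Rightarrow> 'a \<Rightarrow> nat"
    and Y :: "nat \<Rightarrow> 'a \<Rightarrow> 'y"
    and S :: "'a \<Rightarrow> enat"
  assumes "changepoint_model M prior \<mu> K p0 p f g \<eta> \<Theta> X Y"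
    and "assignment_rule K M X Y"
    and "stopping_time (obs_filtration M X Y) S"
    and "AE \<omega> in M. S \<omega> < \<infinity>"
  shows "(lik_ratio_well_defined K prior \<mu> f g \<longrightarrow>
      (\<forall>t. AE \<omega> in M. posterior_odds M X Y \<Theta> t \<omega> =
         (\<integral>\<^sup>+h. ennreal (Gamma_par p0 p f g X Y t h \<omega> * D_par p0 p f X Y t h \<omega>) \<partial>prior) /
         (\<integral>\<^sup>+h. ennreal (D_par p0 p f X Y t h \<omega>) \<partial>prior))) \<and>
    (\<forall>b::real. 0 < b \<longrightarrow>
      \<P>(\<omega> in M. ennreal b \<le> posterior_odds M X Y \<Theta> (the_enat (S \<omega>)) \<omega>) = 1 \<longrightarrow>
      \<P>(\<omega> in M. S \<omega> < \<Theta> \<omega>) \<le> 1 / (1 + b))"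
proof -
  interpret M: changepoint_model M prior \<mu> K p0 p f g \<eta> \<Theta> X Y by fact
  obtain \<xi> where "\<forall>s\<ge>1. \<xi> s \<in> (\<Pi>\<^sub>M r\<in>{1..<s}. borel) \<rightarrow>\<^sub>M count_space {1..K}"
    and "\<forall>s\<ge>1. \<forall>y y'. (\<forall>r\<in>{1..<s}. y r = y' r) \<longrightarrow> \<xi> s y = \<xi> s y'"
    and "\<forall>s\<ge>1. \<forall>\<omega>\<in>space M. X s \<omega> = \<xi> s (\<lambda>r. Y r \<omega>)"
    using assignment_rule_policy[OF assms(2)] by blast
  then interpret policy_model M prior \<mu> K p0 p f g \<eta> \<Theta> X Y \<xi>
    by unfold_locales blast+
  show ?thesis
    using posterior_odds_formula
      M.stopped_posterior_odds_bound[OF X_measurable M.Y_measurable M.Theta_measurable assms(3,4)]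
    by blast
qed

end
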